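(* Let $n\ge 3$, $b>1$, $\bar c\ge 0$ and $\tilde\tau=\frac{n+b+2}{n+b-2}$. Let $\bar u\in C^2(\overline{\mathbb{R}^{n+1}_+})$ be a positive classical solution of $$\Delta_{n+1}\bar u+\frac{b-1}{x_{n+1}}\,\frac{\partial \bar u}{\partial x_{n+1}}+\bar c\,\bar u(x)^{\tilde\tau}=0\ \text{ in }\mathbb{R}^{n+1}_+,\qquad \frac{\partial\bar u}{\partial x_{n+1}}=0\ \text{ on }\partial\mathbb{R}^{n+1}_+,$$ and suppose that the asymptotic behavior of $\bar u$ at infinity is $\bar u(x)\sim\frac{1}{|x|^{n+b-2}}$. Then $\bar u$ satisfies the integral equation $$\bar u(x)=\bar c\int_{\mathbb{R}^{n+1}_+}K_{b-1}(x,y)\,y_{n+1}^{b-1}\,\bar u(y)^{\tilde\tau}\,dy .$$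
   Context: $\mathbb{R}^{n+1}_+=\{x=(x_1,\dots,x_{n+1})\in\mathbb{R}^{n+1} : x_{n+1}>0\}$ and $\Delta_{n+1}$ is the Laplacian in $\mathbb{R}^{n+1}$. The notation $\bar u(x)\sim\frac{1}{|x|^{n+b-2}}$ as $|x|\to\infty$ means that $|x|^{n+b-2}\bar u(x)\to C$ as $|x|\to\infty$ for some constant $C>0$. The kernel $K_{b-1}$ on $\mathbb{R}^{n+1}_+$ is the Green function of $-\mathrm{div}(x_{n+1}^{b-1}\nabla u)$ with homogeneous Neumann condition on $\partial\mathbb{R}^{n+1}_+$: $$K_{b-1}(x,y)=D\int_0^1\left(|x-y|^2(1-\tau)+|x-y^*|^2\tau\right)^{-\frac{n+b-2}{2}}[\tau(1-\tau)]^{\frac{b-1}{2}-1}d\tau,$$ $$D=2^{b-3}\pi^{-\frac{n+1}{2}}\frac{\Gamma(\frac{n+b-2}{2})}{\Gamma(\frac{b-1}{2})},\qquad y^*=(y_1,\dots,y_n,-y_{n+1}).$$ *)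

theory Defs
  imports "HOL-Analysis.Analysis"
begin

text \<open>
  Points of \<open>\<real>\<^sup>n\<^sup>+\<^sup>1\<close> are pairs \<open>(x', x\<^sub>n\<^sub>+\<^sub>1)\<close> in \<open>(real ^ 'n) \<times> real\<close> with \<open>n = CARD('n)\<close>; the
  norm and \<open>lborel\<close> on this product are the Euclidean norm and Lebesgue measure.
\<close>

definition half_space :: "((real ^ 'n) \<times> real) set" where
  "half_space = {x. snd x > 0}"

definition closed_half_space :: "((real ^ 'n) \<times> real) set" where
  "closed_half_space = {x. snd x \<ge> 0}"

definition reflect :: "(real ^ 'n) \<times> real \<Rightarrow> (real ^ 'n) \<times> real" where
  "reflect y = (fst y, - snd y)"

definition partial :: "'a::euclidean_space \<Rightarrow> ('a \<Rightarrow> real) \<Rightarrow> 'a \<Rightarrow> real" where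
  "partial i f x = deriv (\<lambda>t. f (x + t *\<^sub>R i)) 0"

definition laplacian :: "('a::euclidean_space \<Rightarrow> real) \<Rightarrow> 'a \<Rightarrow> real" where
  "laplacian f x = (\<Sum>i\<in>Basis. partial i (partial i f) x)"

text \<open>
  \<open>C_closure k \<Omega> f\<close> is \<open>f \<in> C\<^sup>k(closure \<Omega>)\<close> for open \<open>\<Omega>\<close>: all partial derivatives of order at
  most \<open>k\<close> exist in \<open>\<Omega>\<close> and extend continuously to the closure of \<open>\<Omega>\<close>. The function \<open>g\<close> is the
  partial derivative in \<open>\<Omega>\<close> and its continuous extension on the boundary. Values of
  \<open>f\<close> outside the closure play no role.
\<close>

fun C_closure :: "nat \<Rightarrow> 'a::euclidean_space set \<Rightarrow> ('a \<Rightarrow> real) \<Rightarrow> bool" where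
  "C_closure 0 \<Omega> f \<longleftrightarrow> continuous_on (closure \<Omega>) f"
| "C_closure (Suc k) \<Omega> f \<longleftrightarrow> continuous_on (closure \<Omega>) f \<and>
     (\<forall>i\<in>Basis. \<exists>g. C_closure k \<Omega> g \<and>
        (\<forall>x\<in>\<Omega>. ((\<lambda>t. f (x + t *\<^sub>R i)) has_real_derivative g x) (at 0)))"

text \<open>
  \<open>green_kernel b\<close> is the kernel \<open>K\<^sub>b\<^sub>-\<^sub>1\<close>, and \<open>green_const TYPE('n) b\<close> its constant \<open>D\<close>. On the
  diagonal \<open>x = y\<close> the integral over \<open>\<tau>\<close> diverges and the value is immaterial.
\<close>

definition green_const :: "'n::finite itself \<Rightarrow> real \<Rightarrow> real" where
  "green_const _ b =
     2 powr (b - 3) * pi powr (- (real CARD('n) + 1) / 2) *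
     (Gamma ((real CARD('n) + b - 2) / 2) / Gamma ((b - 1) / 2))"

definition green_kernel :: "real \<Rightarrow> (real ^ 'n::finite) \<times> real \<Rightarrow> (real ^ 'n) \<times> real \<Rightarrow> real" where
  "green_kernel b x y =
     green_const TYPE('n) b *
     (LINT \<tau>:{0..1}|lborel.
        ((norm (x - y))\<^sup>2 * (1 - \<tau>) + (norm (x - reflect y))\<^sup>2 * \<tau>)
          powr (- (real CARD('n) + b - 2) / 2) *
        (\<tau> * (1 - \<tau>)) powr ((b - 1) / 2 - 1))"

text \<open>\<open>u(x) \<sim> 1 / |x|\<^sup>p\<close> as \<open>|x| \<rightarrow> \<infinity>\<close> in \<open>S\<close>.\<close>

definition decays_like :: "('a::real_normed_vector \<Rightarrow> real) \<Rightarrow> 'a set \<Rightarrow> real \<Rightarrow> bool" where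
  "decays_like u S p \<longleftrightarrow>
     (\<exists>C>0. ((\<lambda>x. norm x powr p * u x) \<longlongrightarrow> C) (inf at_infinity (principal S)))"

end

theory Submission
  imports Defs
begin

text \<open>
  Put \<open>a = b - 1\<close>, \<open>k = (n + b - 2) / 2\<close> and \<open>q = |x - y|\<^sup>2 + 4 x\<^sub>n\<^sub>+\<^sub>1 y\<^sub>n\<^sub>+\<^sub>1 \<tau>\<close>, so that the kernel is the average of
  \<open>q powr (- k)\<close> over \<open>\<tau>\<close>. After averaging in \<open>\<tau>\<close>, the operator \<open>\<Delta> + (a / y\<^sub>n\<^sub>+\<^sub>1) \<partial>\<^sub>n\<^sub>+\<^sub>1\<close> acts on functions \<open>F q\<close> as the
  radial Laplacian in the fractional dimension \<open>n + b\<close>, that is \<open>4 q F'' + 2 (n + b) F'\<close>. Testing the equation with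
  a compactly supported difference of two truncations of \<open>q powr (- k)\<close>, at a small radius and at a large one, puts all
  derivatives on the test function and gives an identity between the integral of the nonlinearity and the
  difference of two averages of \<open>u\<close>. The average at the small radius tends to a constant times \<open>u x\<close>, the one at the
  large radius tends to zero by the decay of \<open>u\<close>, and the truncations increase to \<open>q powr (- k)\<close>, so monotone
  convergence yields the integral equation.
\<close>

subsection \<open>The weighted measures\<close>

text \<open>Origin of the average over \<tau>: for integer \<open>b\<close>, a function of a
  horizontal part and a height is a function on R^(n+b) that is radial in the last b variables, and
  \<open>snd y powr a\<close> is, up to a constant, the radial density of Lebesgue measure there.
  The squared distance of two points is then \<open>q\<close> with \<tau> = (1 - cos \<theta>) / 2,
  where \<theta> is the angle between their last parts, and sin^(b-2) \<theta> d\<theta> becomes a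
  multiple of the Beta weight in \<open>om a\<close>. The kernel is thus a spherical average of
  r^(-(n+b-2)), harmonic off the pole. The formulas make sense for real b > 1 and are checked
  directly; what spoils them at a single \<tau> is the angular part of that larger Laplacian. Two
  truncations are subtracted because they agree beyond the larger radius, so that the test function
  has compact support and nothing is lost at infinity. Boundary terms carry
  \<open>snd y powr a\<close>, which vanishes at height 0 since a > 0, and the singular coefficient
  \<open>a / snd y\<close> is integrable against the weight since a - 1 > -1. The constant D is the
  reciprocal of the common mass of the averages, found from a Gaussian integral.\<close>

definition mu :: "real \<Rightarrow> ((real^'n::finite) \<times> real) measure" where
  "mu a = density lborel (\<lambda>y. ennreal (indicator half_space y * snd y powr a))"

definition om :: "real \<Rightarrow> real measure" where
  "om a = density lborel (\<lambda>\<tau>. ennreal (indicator {0..1} \<tau> * (\<tau> * (1 - \<tau>)) powr (a / 2 - 1)))"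

abbreviation nu :: "real \<Rightarrow> (((real^'n::finite) \<times> real) \<times> real) measure" where
  "nu a \<equiv> mu a \<Otimes>\<^sub>M om a"

lemma sets_mu [measurable_cong, simp]: "sets (mu a) = sets borel"
  and space_mu [simp]: "space (mu a) = UNIV"
  by (simp_all add: mu_def)

lemma sets_om [measurable_cong, simp]: "sets (om a) = sets borel"
  and space_om [simp]: "space (om a) = UNIV"
  by (simp_all add: om_def)

lemma half_space_borel [measurable]: "(half_space :: ((real^'n::finite) \<times> real) set) \<in> sets borel"
  unfolding half_space_def by (intro borel_open open_Collect_less continuous_intros)

lemma fst_snd_borel [measurable (raw)]:
  fixes f :: "'c \<Rightarrow> 'a::euclidean_space \<times> 'b::euclidean_space"
  assumes "f \<in> borel_measurable M"
  shows "(\<lambda>x. fst (f x)) \<in> borel_measurable M" "(\<lambda>x. snd (f x)) \<in> borel_measurable M"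
  by (rule measurable_compose[OF assms], rule borel_measurable_continuous_onI, intro continuous_intros)+

lemma cball_borel [measurable]: "cball (c::'a::euclidean_space) r \<in> sets borel"
  by (intro borel_closed closed_cball)

lemma integral_mu:
  fixes h :: "(real^'n::finite) \<times> real \<Rightarrow> real"
  assumes [measurable]: "h \<in> borel_measurable borel"
  shows "integral\<^sup>L (mu a) h = (LINT y|lborel. indicator half_space y * snd y powr a * h y)"
    and "integrable (mu a) h \<longleftrightarrow> integrable lborel (\<lambda>y. indicator half_space y * snd y powr a * h y)"
  unfolding mu_def by (simp_all add: integral_density integrable_density)

lemma integral_om:
  fixes h :: "real \<Rightarrow> real"
  assumes [measurable]: "h \<in> borel_measurable borel"
  shows "integral\<^sup>L (om a) h = (LINT \<tau>|lborel. indicator {0..1} \<tau> * (\<tau> * (1 - \<tau>)) powr (a / 2 - 1) * h \<tau>)"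
    and "integrable (om a) h \<longleftrightarrow> integrable lborel (\<lambda>\<tau>. indicator {0..1} \<tau> * (\<tau> * (1 - \<tau>)) powr (a / 2 - 1) * h \<tau>)"
  unfolding om_def by (simp_all add: integral_density integrable_density)

lemma AE_mu: "AE y in mu a. y \<in> half_space"
  unfolding mu_def by (subst AE_density) (auto split: split_indicator simp: indicator_def)

lemma AE_om: "AE \<tau> in om a. \<tau> \<in> {0..1}"
  unfolding om_def by (subst AE_density) (auto split: split_indicator simp: indicator_def)

lemma AE_mu_neq: "AE y in mu a. y \<noteq> x"
  unfolding mu_def by (subst AE_density) (auto intro: AE_mp[OF AE_lborel_singleton])

lemma om_weight_integrable:
  assumes "a > 0"
  shows "integrable lborel (\<lambda>\<tau>::real. indicator {0..1} \<tau> * (\<tau> * (1 - \<tau>)) powr (a / 2 - 1))"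
proof -
  have "set_integrable lborel {0..1} (\<lambda>t::real. t powr (a/2 - 1) * (1 - t) powr (a/2 - 1))"
    using assms by (intro integrable_Beta) auto
  then show ?thesis
    unfolding set_integrable_def
    by (rule Bochner_Integration.integrable_cong[THEN iffD1, rotated -1]) (auto simp: powr_mult split: split_indicator)
qed

lemma finite_om:
  assumes "a > 0" shows "finite_measure (om a)"
proof
  have "emeasure (om a) (space (om a)) = (\<integral>\<^sup>+\<tau>. ennreal (indicator {0..1} \<tau> * (\<tau> * (1 - \<tau>)) powr (a / 2 - 1)) \<partial>lborel)"
    unfolding om_def by (simp add: emeasure_density)
  also have "\<dots> < \<infinity>"
    using om_weight_integrable[OF assms] unfolding integrable_iff_bounded by simp
  finally show "emeasure (om a) (space (om a)) \<noteq> \<infinity>" by simp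
qed

text \<open>This mass is what the average over \<tau> contributes to the normalising constant: with
  the pole at the origin, \<open>q\<close> does not depend on \<tau>.\<close>

lemma mass_om:
  assumes "a > 0"
  shows "measure (om a) UNIV = Beta (a/2) (a/2)"
proof -
  interpret finite_measure "om a" by (rule finite_om[OF assms])
  have "measure (om a) UNIV = integral\<^sup>L (om a) (\<lambda>_. 1)" by simp
  also have "\<dots> = (LINT \<tau>:{0..1}|lborel. \<tau> powr (a/2 - 1) * (1 - \<tau>) powr (a/2 - 1))"
    by (subst integral_om) (auto simp: set_lebesgue_integral_def powr_mult intro!: Bochner_Integration.integral_cong split: split_indicator)
  also have "\<dots> = integral {0..1} (\<lambda>\<tau>. \<tau> powr (a/2 - 1) * (1 - \<tau>) powr (a/2 - 1))"
    using assms by (intro set_borel_integral_eq_integral integrable_Beta) auto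
  also have "\<dots> = Beta (a/2) (a/2)"
    using assms by (intro integral_unique has_integral_Beta_real) auto
  finally show ?thesis .
qed

lemma sigma_finite_mu: "sigma_finite_measure (mu a)"
  unfolding mu_def by (subst sigma_finite_measure.sigma_finite_iff_density_finite[OF sigma_finite_lborel]) auto

section \<open>Integrability near the degenerate boundary\<close>

lemma powr_integrable:
  assumes "e > -1" "c \<ge> 0"
  shows "integrable lborel (\<lambda>t::real. indicator {0<..c} t * t powr e)"
proof -
  have "(\<lambda>t. t powr e) absolutely_integrable_on {0<..c}"
    using assms by (intro nonnegative_absolutely_integrable_1 integrable_on_powr_from_0') auto
  then have "integrable lebesgue (\<lambda>t::real. indicator {0<..c} t * t powr e)"
    by (simp add: set_integrable_def)
  then show ?thesis by (subst (asm) integrable_completion) auto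
qed

lemma integrable_lborel_prod_mult:
  fixes f :: "'a::euclidean_space \<Rightarrow> real" and g :: "'b::euclidean_space \<Rightarrow> real"
  assumes f: "integrable lborel f" and g: "integrable lborel g"
  shows "integrable lborel (\<lambda>y. f (fst y) * g (snd y))"
  unfolding lborel_prod[symmetric]
proof (rule lborel_pair.Fubini_integrable)
  note [measurable] = borel_measurable_integrable[OF f] borel_measurable_integrable[OF g]
  show "(\<lambda>y. f (fst y) * g (snd y)) \<in> borel_measurable (lborel \<Otimes>\<^sub>M lborel)" by measurable
  show "integrable lborel (\<lambda>x. LINT y|lborel. norm (f (fst (x, y)) * g (snd (x, y))))"
    using f by (simp add: abs_mult)
  show "AE x in lborel. integrable lborel (\<lambda>y. f (fst (x, y)) * g (snd (x, y)))"
    using g by simp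
qed

lemma weight_integrable:
  assumes "e > -1" "r \<ge> 0"
  shows "integrable lborel (\<lambda>y::(real^'n::finite) \<times> real. indicator half_space y * indicator (cball 0 r) y * snd y powr e)"
proof -
  have 1: "integrable lborel (\<lambda>y::(real^'n::finite) \<times> real.
      indicator (cball 0 r) (fst y) * (indicator {0<..r} (snd y) * snd y powr e))"
    by (intro integrable_lborel_prod_mult[of "indicator (cball 0 r)"] powr_integrable[OF assms])
       (auto intro!: integrable_real_indicator emeasure_bounded_finite simp: emeasure_lborel_cbox_finite)
  show ?thesis
  proof (rule Bochner_Integration.integrable_bound[OF 1], goal_cases)
    case 2
    show ?case
    proof (rule AE_I2)
      fix y :: "(real^'n) \<times> real"
      have "norm (fst y) \<le> norm y" "\<bar>snd y\<bar> \<le> norm y" 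
        using norm_fst_le[of "fst y" "snd y"] norm_snd_le[of "snd y" "fst y"] by auto
      then show "norm (indicator half_space y * indicator (cball 0 r) y * snd y powr e)
        \<le> norm (indicator (cball 0 r) (fst y) * (indicator {0<..r} (snd y) * snd y powr e))"
        by (auto simp: half_space_def split: split_indicator)
    qed
  qed measurable
qed

text \<open>The factor \<open>1 + 1 / snd y\<close> models the coefficient \<open>a / snd y\<close>
  of the first-order term. Multiplied by the weight it produces the exponents \<open>a\<close> and
  \<open>a - 1\<close>, both above -1.\<close>

lemma mu_dominating:
  assumes "a > 0" "r \<ge> 0"
  shows "integrable (mu a) (\<lambda>y::(real^'n::finite) \<times> real. indicator half_space y * indicator (cball 0 r) y * (B * (1 + 1 / snd y)))"
proof -
  have "integrable lborel (\<lambda>y::(real^'n::finite) \<times> real. B * (indicator half_space y * indicator (cball 0 r) y * snd y powr a)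
     + B * (indicator half_space y * indicator (cball 0 r) y * snd y powr (a - 1)))"
    using assms by (intro Bochner_Integration.integrable_add integrable_mult_right weight_integrable) auto
  then have "integrable lborel (\<lambda>y::(real^'n) \<times> real. indicator half_space y * snd y powr a *
      (indicator half_space y * indicator (cball 0 r) y * (B * (1 + 1 / snd y))))"
    by (rule Bochner_Integration.integrable_cong[THEN iffD1, rotated -1])
       (auto simp: half_space_def powr_diff field_simps split: split_indicator)
  moreover have "(\<lambda>y::(real^'n) \<times> real. indicator half_space y * indicator (cball 0 r) y * (B * (1 + 1 / snd y)))
      \<in> borel_measurable borel"
    by measurable
  ultimately show ?thesis by (simp only: integral_mu)
qed

lemma integrable_mu_bounded:
  fixes h :: "(real^'n::finite) \<times> real \<Rightarrow> real"
  assumes "a > 0" and [measurable]: "h \<in> borel_measurable borel"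
    and "\<And>y. y \<in> half_space \<Longrightarrow> \<bar>h y\<bar> \<le> B * (1 + 1 / snd y)"
    and "\<And>y. y \<in> half_space \<Longrightarrow> norm y > r \<Longrightarrow> h y = 0"
  shows "integrable (mu a) h"
proof (rule Bochner_Integration.integrable_bound)
  show "integrable (mu a) (\<lambda>y::(real^'n::finite) \<times> real. indicator half_space y * indicator (cball 0 \<bar>r\<bar>) y * (B * (1 + 1 / snd y)))"
    by (intro mu_dominating assms) auto
  show "AE y in mu a. norm (h y) \<le> norm (indicator half_space y * indicator (cball 0 \<bar>r\<bar>) y * (B * (1 + 1 / snd y)))"
    using AE_mu
  proof (eventually_elim)
    case (elim y)
    then show ?case using assms(3,4)[of y] by (fastforce split: split_indicator)
  qed
qed (simp add: measurable_cong_sets[OF sets_mu refl])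

text \<open>The majorant depends on \<open>y\<close> alone, so integration over \<tau> only
  multiplies it by the finite mass of \<open>om a\<close>, and Fubini's criterion applies. Bounds
  are asked for \<tau> in [0, 1], which carries \<open>om a\<close> and where \<open>qf\<close> is
  nonnegative.\<close>

lemma integrable_nu_bounded:
  fixes h :: "((real^'n::finite) \<times> real) \<times> real \<Rightarrow> real"
  assumes "a > 0" and [measurable]: "h \<in> borel_measurable borel"
    and h1: "\<And>y \<tau>. y \<in> half_space \<Longrightarrow> \<tau> \<in> {0..1} \<Longrightarrow> \<bar>h (y, \<tau>)\<bar> \<le> B * (1 + 1 / snd y)"
    and h2: "\<And>y \<tau>. y \<in> half_space \<Longrightarrow> \<tau> \<in> {0..1} \<Longrightarrow> norm y > r \<Longrightarrow> h (y, \<tau>) = 0"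
  shows "integrable (nu a) h"
proof -
  interpret mu: sigma_finite_measure "mu a" by (rule sigma_finite_mu)
  interpret om: finite_measure "om a" by (rule finite_om[OF assms(1)])
  interpret pair_sigma_finite "mu a" "om a" ..
  have s: "sets (nu a) = sets borel"
    by (simp add: borel_prod[symmetric] cong: sets_pair_measure_cong)
  have [measurable]: "h \<in> borel_measurable (nu a)"
    by (simp add: measurable_cong_sets[OF s refl])
  let ?d = "\<lambda>y::(real^'n) \<times> real. indicator half_space y * indicator (cball 0 \<bar>r\<bar>) y * (B * (1 + 1 / snd y))"
  have d: "integrable (mu a) ?d" by (rule mu_dominating) (use assms in auto)
  have AEh: "AE \<tau> in om a. norm (h (y, \<tau>)) \<le> norm (?d y)" if "y \<in> half_space" for y
    using AE_om by eventually_elim (use h1[of y] h2[of y] that in \<open>fastforce split: split_indicator\<close>)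
  have i: "integrable (om a) (\<lambda>\<tau>. h (y, \<tau>))" if "y \<in> half_space" for y
    by (rule Bochner_Integration.integrable_bound[OF om.integrable_const, of _ "?d y"]) (use AEh[OF that] in auto)
  show ?thesis
  proof (rule Fubini_integrable)
    show "AE y in mu a. integrable (om a) (\<lambda>\<tau>. h (y, \<tau>))"
      using AE_mu by eventually_elim (rule i)
    show "integrable (mu a) (\<lambda>y. LINT \<tau>|om a. norm (h (y, \<tau>)))"
    proof (rule Bochner_Integration.integrable_bound)
      show "integrable (mu a) (\<lambda>y. measure (om a) UNIV * ?d y)" using d by simp
      show "AE y in mu a. norm (LINT \<tau>|om a. norm (h (y, \<tau>))) \<le> norm (measure (om a) UNIV * ?d y)"
        using AE_mu
      proof eventually_elim
        case (elim y)
        have "(LINT \<tau>|om a. norm (h (y, \<tau>))) \<le> (LINT \<tau>|om a. norm (?d y))"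
          by (intro integral_mono_AE AEh integrable_norm i elim) auto
        moreover have "0 \<le> (LINT \<tau>|om a. norm (h (y, \<tau>)))" by (rule integral_nonneg_AE) auto
        ultimately show ?case by (simp add: abs_mult)
      qed
    qed measurable
  qed measurable
qed

subsection \<open>Integration by parts in the half space\<close>

lemma compact_support_bounded:
  fixes h :: "'a::euclidean_space \<Rightarrow> real"
  assumes "continuous_on UNIV h" "\<And>y. norm y > r \<Longrightarrow> h y = 0"
  obtains B where "B \<ge> 0" "\<And>y. \<bar>h y\<bar> \<le> B"
proof -
  have "bounded (h ` cball 0 \<bar>r\<bar>)"
    by (intro compact_imp_bounded compact_continuous_image continuous_on_subset[OF assms(1)]) auto
  then obtain B where B: "\<And>y. y \<in> cball 0 \<bar>r\<bar> \<Longrightarrow> \<bar>h y\<bar> \<le> B"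
    unfolding bounded_iff by force
  have "\<bar>h y\<bar> \<le> max B 0" for y
    using B[of y] assms(2)[of y] by (cases "norm y \<le> \<bar>r\<bar>") fastforce+
  then show ?thesis using that[of "max B 0"] by auto
qed

text \<open>Fits a plain bound into the integrability criteria, whose majorants have the factor
  \<open>1 + 1 / snd y\<close>.\<close>

lemma le_one_plus_inverse_height:
  assumes "B \<ge> 0" "y \<in> half_space"
  shows "B \<le> B * (1 + 1 / snd y)"
  using assms by (simp add: half_space_def field_simps)

lemma integral_mu_translate:
  fixes h :: "(real^'n::finite) \<times> real \<Rightarrow> real"
  assumes [measurable]: "h \<in> borel_measurable borel"
  shows "integral\<^sup>L (mu a) (\<lambda>y. h (y + (e, 0))) = integral\<^sup>L (mu a) h"
proof -
  let ?k = "\<lambda>y. indicator half_space y * snd y powr a * h y"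
  have "integral\<^sup>L (mu a) h = (LINT y|lborel. ?k y)" by (simp add: integral_mu)
  also have "\<dots> = (LINT y|distr lborel borel ((+) (e, 0)). ?k y)" by (simp add: lborel_distr_plus)
  also have "\<dots> = (LINT y|lborel. ?k ((e, 0) + y))" by (subst integral_distr) auto
  also have "\<dots> = (LINT y|lborel. indicator half_space y * snd y powr a * h (y + (e, 0)))"
    by (intro Bochner_Integration.integral_cong) (auto simp: half_space_def add.commute indicator_def)
  also have "\<dots> = integral\<^sup>L (mu a) (\<lambda>y. h (y + (e, 0)))" by (subst integral_mu) auto
  finally show ?thesis by simp
qed

text \<open>The weight does not see the horizontal variables, so horizontal translations preserve
  \<open>mu a\<close>. Every difference quotient of \<open>h\<close> therefore integrates to zero,
  and dominated convergence passes this on to \<open>h'\<close>.\<close>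

lemma integral_mu_horizontal_derivative:
  fixes h h' :: "(real^'n::finite) \<times> real \<Rightarrow> real"
  assumes a: "a > 0" and c: "continuous_on UNIV h" "continuous_on UNIV h'"
    and z: "\<And>y. norm y > r \<Longrightarrow> h y = 0" "\<And>y. norm y > r \<Longrightarrow> h' y = 0"
    and d: "\<And>y. y \<in> half_space \<Longrightarrow> ((\<lambda>t. h (y + t *\<^sub>R (e, 0))) has_real_derivative h' y) (at 0)"
  shows "integral\<^sup>L (mu a) h' = 0"
proof -
  have [measurable]: "h \<in> borel_measurable borel" "h' \<in> borel_measurable borel"
    using c by (auto intro: borel_measurable_continuous_onI)
  obtain B where B: "B \<ge> 0" "\<And>y. \<bar>h y\<bar> \<le> B" using compact_support_bounded[OF c(1) z(1)] by blast
  obtain B' where B': "B' \<ge> 0" "\<And>y. \<bar>h' y\<bar> \<le> B'" using compact_support_bounded[OF c(2) z(2)] by blast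
  define \<delta> where "\<delta> k = 1 / real (Suc k)" for k
  have \<delta>: "\<delta> k > 0" "\<delta> k \<le> 1" for k by (auto simp: \<delta>_def)
  have \<delta>0: "\<delta> \<longlonglongrightarrow> 0" unfolding \<delta>_def by (rule LIMSEQ_Suc[OF lim_1_over_n])
  define D where "D k y = (h (y + (\<delta> k *\<^sub>R e, 0)) - h y) / \<delta> k" for k y
  have int: "integrable (mu a) h"
    using B z by (intro integrable_mu_bounded[OF a, where B = B and r = r])
      (auto intro: order.trans[OF B(2)] le_one_plus_inverse_height)
  \<comment> \<open>The steps \<open>\<delta> k\<close> are at most 1, so all shifted supports stay
    in this ball; inside it the mean value theorem bounds the quotients by
    \<open>B'\<close>.\<close>
  have bd: "integrable (mu a) (\<lambda>y::(real^'n) \<times> real. indicator (cball 0 (\<bar>r\<bar> + norm e)) y * B')"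
    using B' by (intro integrable_mu_bounded[OF a, where B = B' and r = "\<bar>r\<bar> + norm e"])
      (auto simp: indicator_def half_space_def algebra_simps)
  have nrm: "norm y > r" if "norm y > \<bar>r\<bar> + norm e" for y :: "(real^'n) \<times> real" 
    using that by (smt (verit) norm_ge_zero)
  have nrm': "norm (y + (\<delta> k *\<^sub>R e, 0)) > r" if "norm y > \<bar>r\<bar> + norm e" for y :: "(real^'n) \<times> real" and k
  proof -
    have "norm (\<delta> k *\<^sub>R e, 0::real) \<le> norm e" using \<delta>[of k] by (simp add: norm_Pair mult_left_le_one_le)
    then show ?thesis using that norm_diff_ineq[of y "(\<delta> k *\<^sub>R e, 0)"] by linarith
  qed
  have dom: "norm (D k y) \<le> indicator (cball 0 (\<bar>r\<bar> + norm e)) y * B'" if y: "y \<in> half_space" for k y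
  proof (cases "norm y \<le> \<bar>r\<bar> + norm e")
    case True
    have der: "((\<lambda>t. h (y + t *\<^sub>R (e, 0))) has_real_derivative h' (y + s *\<^sub>R (e, 0))) (at s)" for s
    proof -
      have "y + s *\<^sub>R (e, 0) \<in> half_space" using y by (auto simp: half_space_def)
      from d[OF this] have "((\<lambda>t. h (y + (t + s) *\<^sub>R (e, 0))) has_real_derivative h' (y + s *\<^sub>R (e, 0))) (at 0)"
        by (simp add: algebra_simps)
      then show ?thesis
        using DERIV_shift[of "\<lambda>t. h (y + t *\<^sub>R (e, 0))" "h' (y + s *\<^sub>R (e, 0))" 0 s] by simp
    qed
    obtain s where "h (y + \<delta> k *\<^sub>R (e, 0)) - h (y + 0 *\<^sub>R (e, 0)) = (\<delta> k - 0) * h' (y + s *\<^sub>R (e, 0))"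
      using MVT2[OF \<delta>(1)[of k], of "\<lambda>t. h (y + t *\<^sub>R (e, 0))" "\<lambda>s. h' (y + s *\<^sub>R (e, 0))"] der by blast
    then have "D k y = h' (y + s *\<^sub>R (e, 0))" using \<delta>(1)[of k] by (simp add: D_def zero_prod_def[symmetric])
    then show ?thesis using True B'(2) by simp
  next
    case False
    then show ?thesis using nrm[of y] nrm'[of y] z by (auto simp: D_def)
  qed
  have conv: "(\<lambda>k. D k y) \<longlonglongrightarrow> h' y" if "y \<in> half_space" for y
  proof -
    have "((\<lambda>t. (h (y + t *\<^sub>R (e, 0)) - h (y + 0 *\<^sub>R (e, 0))) / t) \<longlongrightarrow> h' y) (at 0)"
      using d[OF that] by (simp add: DERIV_def)
    moreover have "filterlim \<delta> (at 0) sequentially"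
      using \<delta>0 by (intro filterlim_atI) (auto intro!: always_eventually simp: \<delta>_def)
    ultimately have "(\<lambda>k. (h (y + \<delta> k *\<^sub>R (e, 0)) - h (y + 0 *\<^sub>R (e, 0))) / \<delta> k) \<longlonglongrightarrow> h' y"
      by (rule filterlim_compose)
    then show ?thesis by (simp add: D_def zero_prod_def[symmetric])
  qed
  have "(\<lambda>k. integral\<^sup>L (mu a) (D k)) \<longlonglongrightarrow> integral\<^sup>L (mu a) h'"
  proof (rule integral_dominated_convergence[OF _ _ bd])
    show "AE y in mu a. (\<lambda>k. D k y) \<longlonglongrightarrow> h' y" using AE_mu by eventually_elim (rule conv)
    show "AE y in mu a. norm (D k y) \<le> indicator (cball 0 (\<bar>r\<bar> + norm e)) y * B'" for k
      using AE_mu by eventually_elim (rule dom)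
  qed (unfold D_def[abs_def] measurable_cong_sets[OF sets_mu refl], measurable)
  moreover have "integral\<^sup>L (mu a) (D k) = 0" for k
  proof -
    have "integrable (mu a) (\<lambda>y. h (y + (\<delta> k *\<^sub>R e, 0)))"
      by (rule integrable_mu_bounded[OF a, where B = B and r = "\<bar>r\<bar> + norm e"])
        (use nrm' z B in \<open>auto intro: order.trans[OF B(2)] le_one_plus_inverse_height\<close>)
    then show ?thesis
      unfolding D_def using int integral_mu_translate[of h a "\<delta> k *\<^sub>R e"] by simp
  qed
  ultimately show ?thesis by (simp add: LIMSEQ_const_iff)
qed

text \<open>Multiplied by the weight, the integrand is the derivative of \<open>t powr a * v\<close>
  along vertical lines. By Fubini almost every such line may be treated alone, and the fundamental
  theorem leaves two end values: the upper one lies outside the support, the lower one carries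
  \<open>0 powr a = 0\<close>.\<close>

lemma integral_mu_vertical_derivative:
  fixes v v' :: "(real^'n::finite) \<times> real \<Rightarrow> real"
  assumes a: "a > 0" and c: "continuous_on UNIV v" "continuous_on UNIV v'"
    and z: "\<And>y. norm y > r \<Longrightarrow> v y = 0" "\<And>y. norm y > r \<Longrightarrow> v' y = 0"
    and d: "\<And>y. y \<in> half_space \<Longrightarrow> ((\<lambda>t. v (y + t *\<^sub>R (0, 1))) has_real_derivative v' y) (at 0)"
  shows "integral\<^sup>L (mu a) (\<lambda>y. v' y + a / snd y * v y) = 0"
proof -
  have [measurable]: "v \<in> borel_measurable borel" "v' \<in> borel_measurable borel"
    using c by (auto intro: borel_measurable_continuous_onI)
  obtain B where B: "B \<ge> 0" "\<And>y. \<bar>v y\<bar> \<le> B" using compact_support_bounded[OF c(1) z(1)] by blast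
  obtain B' where B': "B' \<ge> 0" "\<And>y. \<bar>v' y\<bar> \<le> B'" using compact_support_bounded[OF c(2) z(2)] by blast
  define w where "w y = indicator half_space y * snd y powr a * (v' y + a / snd y * v y)" for y :: "(real^'n) \<times> real"
  have "integrable (mu a) (\<lambda>y. v' y + a / snd y * v y)"
  proof (rule integrable_mu_bounded[OF a, where B = "B' + a * B" and r = r])
    fix y :: "(real^'n) \<times> real" assume y: "y \<in> half_space"
    have "\<bar>v' y + a / snd y * v y\<bar> \<le> B' + a / snd y * B"
      using a y B'(2)[of y] B(2)[of y]
      by (intro order.trans[OF abs_triangle_ineq] add_mono) (auto simp: half_space_def abs_mult intro!: mult_left_mono divide_right_mono)
    also have "\<dots> \<le> (B' + a * B) * (1 + 1 / snd y)"
      using a y B(1) B'(1) by (simp add: half_space_def field_simps)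
    finally show "\<bar>v' y + a / snd y * v y\<bar> \<le> (B' + a * B) * (1 + 1 / snd y)" .
  qed (use z in auto)
  then have w: "integrable lborel w" unfolding w_def by (subst (asm) integral_mu) auto
  \<comment> \<open>The extra 1 makes every point at height \<open>R\<close> or above have norm
    strictly greater than \<open>r\<close>.\<close>
  define R where "R = \<bar>r\<bar> + 1"
  have inner: "(LINT t|lborel. w (p, t)) = 0" if i: "integrable lborel (\<lambda>t. w (p, t))" for p
  proof -
    let ?g = "\<lambda>t. t powr a * v' (p, t) + a * t powr (a - 1) * v (p, t)"
    have n: "norm (p, t) > r" if "t > R" for t using norm_snd_le[of t p] that by (auto simp: R_def)
    \<comment> \<open>At t = 0 both sides vanish by the convention that \<open>0 powr s\<close> is 0
      for every \<open>s\<close>, also when \<open>a - 1\<close> is negative.\<close>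
    have eq: "w (p, t) = indicator {0..R} t *\<^sub>R ?g t" for t
      using n[of t] z[of "(p, t)"] 
      by (cases "t > R") (auto simp: w_def half_space_def indicator_def powr_diff field_simps)
    \<comment> \<open>The derivative is known only at positive height, while
      \<open>t powr a * v (p, t)\<close> is continuous down to 0; hence the version of the
      fundamental theorem with interior derivatives.\<close>
    have "((\<lambda>t. ?g t) has_integral (R powr a * v (p, R) - 0 powr a * v (p, 0))) {0..R}"
    proof (rule fundamental_theorem_of_calculus_interior)
      show "continuous_on {0..R} (\<lambda>t. t powr a * v (p, t))"
        using a by (intro continuous_intros continuous_on_powr' continuous_on_compose2[OF c(1)]) auto
      fix t assume t: "t \<in> {0<..<R}"
      have "((\<lambda>h. v ((p, t) + h *\<^sub>R (0, 1))) has_real_derivative v' (p, t)) (at 0)"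
        using t by (intro d) (auto simp: half_space_def)
      then have "((\<lambda>h. v (p, h + t)) has_real_derivative v' (p, t)) (at 0)" by (simp add: add.commute)
      then have "((\<lambda>h. v (p, h)) has_real_derivative v' (p, t)) (at t)"
        using DERIV_shift[of "\<lambda>h. v (p, h)" "v' (p, t)" 0 t] by simp
      then have "((\<lambda>t. t powr a * v (p, t)) has_real_derivative ?g t) (at t)"
        using t by (auto intro!: derivative_eq_intros simp: algebra_simps)
      then show "((\<lambda>t. t powr a * v (p, t)) has_vector_derivative ?g t) (at t)"
        by (simp add: has_real_derivative_iff_has_vector_derivative)
    qed (simp add: R_def)
    moreover have "v (p, R) = 0" using norm_snd_le[of R p] by (intro z) (auto simp: R_def)
    ultimately have 0: "integral {0..R} ?g = 0" using a by (simp add: integral_unique)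
    have "set_integrable lborel {0..R} ?g" using i unfolding set_integrable_def eq .
    from set_borel_integral_eq_integral(2)[OF this] 0 show ?thesis
      unfolding set_lebesgue_integral_def eq by simp
  qed
  have "(LINT y|lborel. w y) = (LINT p|lborel. LINT t|lborel. w (p, t))"
    using lborel_pair.integral_fst'[of w] w by (simp add: lborel_prod)
  also have "\<dots> = (LINT p|(lborel::(real^'n) measure). 0)"
  proof (rule integral_cong_AE)
    have "AE p in lborel. integrable lborel (\<lambda>t. w (p, t))"
      using lborel_pair.AE_integrable_fst'[of w] w by (simp add: lborel_prod)
    then show "AE p in lborel. (LINT t|lborel. w (p, t)) = 0" by eventually_elim (rule inner)
    show "(\<lambda>p. LINT t|lborel. w (p, t)) \<in> borel_measurable lborel"
      using lborel_pair.integrable_fst'[of w] w by (simp add: lborel_prod)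
  qed simp
  finally show ?thesis unfolding w_def by (subst integral_mu) auto
qed

subsection \<open>Green's formula against radial functions\<close>

definition qf :: "(real^'n::finite) \<times> real \<Rightarrow> (real^'n) \<times> real \<Rightarrow> real \<Rightarrow> real" where
  "qf x y \<tau> = (norm (x - y))\<^sup>2 * (1 - \<tau>) + (norm (x - reflect y))\<^sup>2 * \<tau>"

lemma norm_Pair_real_squared: "(norm (p, t::real))\<^sup>2 = (norm p)\<^sup>2 + t\<^sup>2"
  by (simp add: norm_Pair)

lemma qf_eq: "qf x y \<tau> = (norm (x - y))\<^sup>2 + 4 * snd x * snd y * \<tau>"
  by (cases x; cases y) (simp add: qf_def reflect_def norm_Pair_real_squared power2_diff power2_sum algebra_simps)

lemma norm_reflect: "norm (reflect y) = norm y"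
  by (cases y) (simp add: reflect_def norm_Pair)

text \<open>\<open>qf\<close> is a convex combination of the squared distances from \<open>x\<close>
  to \<open>y\<close> and to its reflection. Reflection keeps the norm, so the reverse triangle
  inequality gives the same lower bound for both.\<close>

lemma qf_lower_bound:
  assumes "\<tau> \<in> {0..1}"
  shows "(norm y - norm x)\<^sup>2 \<le> qf x y \<tau>"
proof -
  have 1: "(norm y - norm x)\<^sup>2 \<le> (norm (x - y))\<^sup>2"
    using norm_triangle_ineq3[of x y] by (intro abs_le_square_iff[THEN iffD1]) auto
  have 2: "(norm y - norm x)\<^sup>2 \<le> (norm (x - reflect y))\<^sup>2"
    using norm_triangle_ineq3[of x "reflect y"] by (intro abs_le_square_iff[THEN iffD1]) (auto simp: norm_reflect)
  have "(norm y - norm x)\<^sup>2 * (1 - \<tau>) + (norm y - norm x)\<^sup>2 * \<tau> \<le> qf x y \<tau>"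
    unfolding qf_def using assms by (intro add_mono mult_right_mono 1 2) auto
  then show ?thesis by (simp add: algebra_simps)
qed

text \<open>Controls the support of test functions: if \<open>F\<close> vanishes from
  \<open>M\<close> on, then \<open>F (qf x y \<tau>)\<close> vanishes outside one ball that serves
  all \<tau> in [0, 1].\<close>

lemma qf_large:
  assumes "\<tau> \<in> {0..1}" "norm y > norm x + sqrt \<bar>M\<bar>"
  shows "qf x y \<tau> \<ge> M"
proof -
  have "\<bar>M\<bar> = (sqrt \<bar>M\<bar>)\<^sup>2" by simp
  also have "\<dots> \<le> (norm y - norm x)\<^sup>2" using assms by (intro power_mono) auto
  also have "\<dots> \<le> qf x y \<tau>" by (rule qf_lower_bound) fact
  finally show ?thesis by simp
qed

lemma Basis_prod_real: "(Basis :: ('a::euclidean_space \<times> real) set) = insert (0, 1) ((\<lambda>e. (e, 0)) ` Basis)"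
  by (auto simp: Basis_prod_def)

text \<open>Integrates the divergence of the field U' \<phi> - U \<phi>' with \<phi> = F (q), one
  coordinate at a time: horizontal components integrate to zero by themselves, the vertical one
  together with its drift \<open>a / snd y\<close>. The bracket that is subtracted is the excess
  left because \<tau> is frozen.\<close>

lemma weighted_green_fixed:
  fixes U f :: "(real^'n::finite) \<times> real \<Rightarrow> real" and g gg :: "(real^'n) \<times> real \<Rightarrow> (real^'n) \<times> real \<Rightarrow> real" and x :: "(real^'n) \<times> real"
  assumes a: "a > 0"
    and cU: "continuous_on UNIV U"
    and cg: "\<And>i. i \<in> Basis \<Longrightarrow> continuous_on UNIV (g i)"
    and cgg: "\<And>i. i \<in> Basis \<Longrightarrow> continuous_on UNIV (gg i)"
    and dU: "\<And>i y. i \<in> Basis \<Longrightarrow> y \<in> half_space \<Longrightarrow> ((\<lambda>t. U (y + t *\<^sub>R i)) has_real_derivative g i y) (at 0)"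
    and dg: "\<And>i y. i \<in> Basis \<Longrightarrow> y \<in> half_space \<Longrightarrow> ((\<lambda>t. g i (y + t *\<^sub>R i)) has_real_derivative gg i y) (at 0)"
    and eq: "\<And>y. y \<in> half_space \<Longrightarrow> (\<Sum>i\<in>Basis. gg i y) + a / snd y * g (0, 1) y = - f y"
    and fm [measurable]: "f \<in> borel_measurable borel"
    and F1: "\<And>z. (F has_real_derivative F1 z) (at z)"
    and F2: "\<And>z. (F1 has_real_derivative F2 z) (at z)"
    and cF2: "continuous_on UNIV F2"
    and F0: "\<And>z. z \<ge> M \<Longrightarrow> F z = 0 \<and> F1 z = 0 \<and> F2 z = 0"
    and \<tau>: "\<tau> \<in> {0..1}"
  defines "q \<equiv> \<lambda>y. qf x y \<tau>"
  shows "(LINT y|mu a. f y * F (q y) + U y * (4 * q y * F2 (q y) + 2 * (real CARD('n) + 1 + a) * F1 (q y)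
      - (16 * (snd x)\<^sup>2 * (\<tau> * (1 - \<tau>)) * F2 (q y) + 2 * a * (snd x / snd y) * (1 - 2 * \<tau>) * F1 (q y)))) = 0"
proof -
  have cF: "continuous_on UNIV F" and cF1: "continuous_on UNIV F1"
    by (rule DERIV_continuous_on, rule has_field_derivative_at_within, rule F1 F2)+
  have cq: "continuous_on UNIV q" unfolding q_def qf_eq by (intro continuous_intros)
  have [measurable]: "F \<in> borel_measurable borel" "F1 \<in> borel_measurable borel" "F2 \<in> borel_measurable borel"
     "q \<in> borel_measurable borel" "U \<in> borel_measurable borel"
    using cF cF1 cF2 cq cU by (auto intro: borel_measurable_continuous_onI)
  \<comment> \<open>The gradient of \<open>q\<close>. Along each coordinate line \<open>q\<close> is
    a quadratic polynomial with leading coefficient 1, so the derivatives of \<phi> come from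
    one-variable chain rules.\<close>
  define w where "w y = 2 *\<^sub>R (y - x) + (4 * snd x * \<tau>) *\<^sub>R (0, 1)" for y
  define \<phi> where "\<phi> y = F (q y)" for y
  define \<phi>1 where "\<phi>1 i y = F1 (q y) * (w y \<bullet> i)" for i y
  define \<phi>2 where "\<phi>2 i y = F2 (q y) * (w y \<bullet> i)\<^sup>2 + 2 * F1 (q y)" for i y
  have q_line: "q (y + t *\<^sub>R i) = q y + t * (w y \<bullet> i) + t\<^sup>2" if "i \<in> Basis" for y t i
  proof -
    have "(norm (x - (y + t *\<^sub>R i)))\<^sup>2 = (norm (x - y))\<^sup>2 + 2 * t * ((y - x) \<bullet> i) + t\<^sup>2 * (i \<bullet> i)"
    proof -
      have "x - (y + t *\<^sub>R i) = - ((y - x) + t *\<^sub>R i)" by simp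
      then have "(norm (x - (y + t *\<^sub>R i)))\<^sup>2 = (norm ((y - x) + t *\<^sub>R i))\<^sup>2" by (simp only: norm_minus_cancel)
      also have "\<dots> = (norm (y - x))\<^sup>2 + 2 * t * ((y - x) \<bullet> i) + t\<^sup>2 * (i \<bullet> i)"
        by (simp only: power2_norm_eq_inner inner_add_left inner_add_right inner_scaleR_left inner_scaleR_right)
          (simp add: inner_commute power2_eq_square distrib_left mult.assoc)
      finally show ?thesis by (simp only: norm_minus_commute)
    qed
    moreover have "(0, c) \<bullet> i = c * snd i" for c :: real by (cases i) simp
    ultimately show ?thesis using that
      by (simp add: q_def qf_eq w_def inner_add_left algebra_simps)
  qed
  have w_line: "w (y + t *\<^sub>R i) \<bullet> i = w y \<bullet> i + 2 * t" if "i \<in> Basis" for y t i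
    using that by (simp add: w_def inner_add_left inner_diff_left algebra_simps)
  have dq: "((\<lambda>t. q y + t * (w y \<bullet> i) + t\<^sup>2) has_real_derivative w y \<bullet> i) (at 0)" for y i
    by (auto intro!: derivative_eq_intros)
  have d\<phi>: "((\<lambda>t. \<phi> (y + t *\<^sub>R i)) has_real_derivative \<phi>1 i y) (at 0)" if "i \<in> Basis" for y i
    unfolding \<phi>_def \<phi>1_def q_line[OF that]
    using DERIV_chain2[OF F1 dq[of y i]] by simp
  have d\<phi>1: "((\<lambda>t. \<phi>1 i (y + t *\<^sub>R i)) has_real_derivative \<phi>2 i y) (at 0)" if "i \<in> Basis" for y i
  proof -
    have "((\<lambda>t. w y \<bullet> i + 2 * t) has_real_derivative 2) (at 0)"
      by (auto intro!: derivative_eq_intros)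
    from DERIV_mult[OF DERIV_chain2[OF F2 dq[of y i]] this] show ?thesis
      unfolding \<phi>1_def \<phi>2_def q_line[OF that] w_line[OF that]
      by (simp add: power2_eq_square mult_ac)
  qed
  \<comment> \<open>The products of first derivatives cancel in the derivative of
    \<open>h i\<close>, so \<open>h' i\<close> contains second derivatives only.\<close>
  define h where "h i y = g i y * \<phi> y - U y * \<phi>1 i y" for i y
  define h' where "h' i y = gg i y * \<phi> y - U y * \<phi>2 i y" for i y
  have c\<phi>: "continuous_on UNIV \<phi>" "continuous_on UNIV (\<phi>1 i)" "continuous_on UNIV (\<phi>2 i)" for i
    unfolding \<phi>_def \<phi>1_def \<phi>2_def w_def
    by (intro continuous_intros continuous_on_compose2[OF cF cq] continuous_on_compose2[OF cF1 cq]
        continuous_on_compose2[OF cF2 cq] subset_UNIV)+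
  have ch: "continuous_on UNIV (h i)" "continuous_on UNIV (h' i)" if "i \<in> Basis" for i
    unfolding h_def h'_def by (intro continuous_intros c\<phi> cU cg cgg that)+
  define r where "r = norm x + sqrt \<bar>M\<bar>"
  have zero: "F (q y) = 0 \<and> F1 (q y) = 0 \<and> F2 (q y) = 0" if "norm y > r" for y
    using qf_large[OF \<tau>, of x M y] that F0 unfolding q_def r_def by blast
  have zh: "h i y = 0" "h' i y = 0" if "norm y > r" for i y
    using zero[OF that] by (auto simp: h_def h'_def \<phi>_def \<phi>1_def \<phi>2_def)
  have dh: "((\<lambda>t. h i (y + t *\<^sub>R i)) has_real_derivative h' i y) (at 0)" if "i \<in> Basis" "y \<in> half_space" for i y
    using DERIV_diff[OF DERIV_mult[OF dg[OF that] d\<phi>[OF that(1), of y]] DERIV_mult[OF dU[OF that] d\<phi>1[OF that(1), of y]]]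
    unfolding h_def h'_def by (rule DERIV_cong) (simp add: algebra_simps)
  define S where "S = (\<lambda>e::real^'n. (e, 0::real)) ` Basis"
  have S: "Basis = insert (0, 1) S" "(0, 1) \<notin> S" "finite S" unfolding S_def by (auto simp: Basis_prod_real)
  have hor: "integral\<^sup>L (mu a) (h' i) = 0" "integrable (mu a) (h' i)" if iS: "i \<in> S" for i
  proof -
    have iB: "i \<in> Basis" using iS S by auto
    obtain e where i: "i = (e, 0)" using iS by (auto simp: S_def)
    show "integral\<^sup>L (mu a) (h' i) = 0"
      by (rule integral_mu_horizontal_derivative[OF a ch[OF iB] zh, where e = e]) (use dh[OF iB] i in auto)
    obtain B where B: "B \<ge> 0" "\<And>y. \<bar>h' i y\<bar> \<le> B" using compact_support_bounded[OF ch(2)[OF iB] zh(2)] by blast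
    show "integrable (mu a) (h' i)"
      by (rule integrable_mu_bounded[OF a, where B = B and r = r])
        (use B zh ch[OF iB] in \<open>auto intro!: borel_measurable_continuous_onI intro: order.trans[OF B(2)] le_one_plus_inverse_height\<close>)
  qed
  have b01: "(0, 1) \<in> (Basis :: ((real^'n) \<times> real) set)" using S by auto
  let ?v = "\<lambda>y. h' (0, 1) y + a / snd y * h (0, 1) y"
  have ver: "integral\<^sup>L (mu a) ?v = 0" "integrable (mu a) ?v"
  proof -
    show "integral\<^sup>L (mu a) ?v = 0"
      by (rule integral_mu_vertical_derivative[OF a ch[OF b01] zh]) (use dh[OF b01] in auto)
    obtain B where B: "B \<ge> 0" "\<And>y. \<bar>h (0, 1) y\<bar> \<le> B" using compact_support_bounded[OF ch(1)[OF b01] zh(1)] by blast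
    obtain B' where B': "B' \<ge> 0" "\<And>y. \<bar>h' (0, 1) y\<bar> \<le> B'" using compact_support_bounded[OF ch(2)[OF b01] zh(2)] by blast
    have [measurable]: "h (0, 1) \<in> borel_measurable borel" "h' (0, 1) \<in> borel_measurable borel"
      using ch[OF b01] by (auto intro: borel_measurable_continuous_onI)
    show "integrable (mu a) ?v"
    proof (rule integrable_mu_bounded[OF a, where B = "B' + a * B" and r = r])
      fix y :: "(real^'n) \<times> real" assume y: "y \<in> half_space"
      have "\<bar>?v y\<bar> \<le> B' + a / snd y * B"
        using a y B'(2)[of y] B(2)[of y]
        by (intro order.trans[OF abs_triangle_ineq] add_mono) (auto simp: half_space_def abs_mult intro!: mult_left_mono divide_right_mono)
      also have "\<dots> \<le> (B' + a * B) * (1 + 1 / snd y)"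
        using a y B(1) B'(1) by (simp add: half_space_def field_simps)
      finally show "\<bar>?v y\<bar> \<le> (B' + a * B) * (1 + 1 / snd y)" .
    qed (use zh in auto)
  qed
  have total: "(LINT y|mu a. (\<Sum>i\<in>S. h' i y) + ?v y) = 0"
    using hor ver by simp
  have pt: "(\<Sum>i\<in>S. h' i y) + ?v y = - (f y * F (q y) + U y * (4 * q y * F2 (q y) + 2 * (real CARD('n) + 1 + a) * F1 (q y)
      - (16 * (snd x)\<^sup>2 * (\<tau> * (1 - \<tau>)) * F2 (q y) + 2 * a * (snd x / snd y) * (1 - 2 * \<tau>) * F1 (q y))))"
    if y: "y \<in> half_space" for y
  proof -
    have t: "snd y > 0" using y by (simp add: half_space_def)
    \<comment> \<open>The gradient of a squared distance has squared length 4 q. At fixed \<tau>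
      there is a deficit, the first part of the excess.\<close>
    have "(\<Sum>i\<in>Basis. (w y \<bullet> i)\<^sup>2) = (norm (w y))\<^sup>2"
      unfolding power2_norm_eq_inner by (simp add: euclidean_inner[of "w y" "w y"] power2_eq_square)
    also have "\<dots> = 4 * (norm (y - x))\<^sup>2 + 4 * (4 * snd x * \<tau>) * ((y - x) \<bullet> (0, 1)) + (4 * snd x * \<tau>)\<^sup>2"
      by (simp only: w_def power2_norm_eq_inner inner_add_left inner_add_right inner_scaleR_left inner_scaleR_right)
        (simp add: inner_commute power2_eq_square distrib_left mult_ac)
    also have "(y - x) \<bullet> (0, 1) = snd y - snd x" by (cases x; cases y) simp
    also have "4 * (norm (y - x))\<^sup>2 + 4 * (4 * snd x * \<tau>) * (snd y - snd x) + (4 * snd x * \<tau>)\<^sup>2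
        = 4 * q y - 16 * (snd x)\<^sup>2 * (\<tau> * (1 - \<tau>))"
      unfolding q_def qf_eq norm_minus_commute[of x y] by (simp add: power2_eq_square algebra_simps)
    finally have sw: "(\<Sum>i\<in>Basis. (w y \<bullet> i)\<^sup>2) = 4 * q y - 16 * (snd x)\<^sup>2 * (\<tau> * (1 - \<tau>))" .
    have w01: "w y \<bullet> (0, 1) = 2 * (snd y - snd x) + 4 * snd x * \<tau>"
      by (cases x; cases y) (simp add: w_def)
    have s2: "(\<Sum>i\<in>Basis. \<phi>2 i y) = F2 (q y) * (\<Sum>i\<in>Basis. (w y \<bullet> i)\<^sup>2) + 2 * (real CARD('n) + 1) * F1 (q y)"
      unfolding \<phi>2_def sum.distrib sum_distrib_left[symmetric] by (simp add: algebra_simps)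
    have "(\<Sum>i\<in>S. h' i y) + ?v y = (\<Sum>i\<in>Basis. h' i y) + a / snd y * h (0, 1) y"
      unfolding S(1) using S(2,3) by simp
    also have "\<dots> = \<phi> y * ((\<Sum>i\<in>Basis. gg i y) + a / snd y * g (0, 1) y) - U y * ((\<Sum>i\<in>Basis. \<phi>2 i y) + a / snd y * \<phi>1 (0, 1) y)"
      unfolding h'_def h_def sum_subtractf sum_distrib_left[symmetric] sum_distrib_right[symmetric] by (simp add: algebra_simps)
    also have "\<dots> = - \<phi> y * f y - U y * (F2 (q y) * (4 * q y - 16 * (snd x)\<^sup>2 * (\<tau> * (1 - \<tau>))) + 2 * (real CARD('n) + 1) * F1 (q y)
       + a / snd y * (F1 (q y) * (2 * (snd y - snd x) + 4 * snd x * \<tau>)))"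
      unfolding eq[OF y] s2 sw \<phi>1_def w01 by simp
    \<comment> \<open>The drift supplies the missing \<open>a\<close> dimensions as
      \<open>2 * a * F1\<close>; its remainder is the second part of the excess.\<close>
    also have "a / snd y * (F1 (q y) * (2 * (snd y - snd x) + 4 * snd x * \<tau>))
        = 2 * a * F1 (q y) - 2 * a * (snd x / snd y) * (1 - 2 * \<tau>) * F1 (q y)"
      using t by (simp add: field_simps)
    finally show ?thesis unfolding \<phi>_def by (simp add: algebra_simps)
  qed
  have hm: "h' i \<in> borel_measurable borel" "h i \<in> borel_measurable borel" if "i \<in> Basis" for i
    using ch[OF that] by (auto intro: borel_measurable_continuous_onI)
  have "(LINT y|mu a. (\<Sum>i\<in>S. h' i y) + ?v y) = (LINT y|mu a. - (f y * F (q y) + U y * (4 * q y * F2 (q y) + 2 * (real CARD('n) + 1 + a) * F1 (q y)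
      - (16 * (snd x)\<^sup>2 * (\<tau> * (1 - \<tau>)) * F2 (q y) + 2 * a * (snd x / snd y) * (1 - 2 * \<tau>) * F1 (q y)))))"
  proof (rule integral_cong_AE)
    show "(\<lambda>y. (\<Sum>i\<in>S. h' i y) + ?v y) \<in> borel_measurable (mu a)"
      unfolding measurable_cong_sets[OF sets_mu refl]
    proof (rule borel_measurable_add)
      show "(\<lambda>y. \<Sum>i\<in>S. h' i y) \<in> borel_measurable borel"
        using S(1) by (intro borel_measurable_sum hm) auto
      note [measurable] = hm[OF b01]
      show "?v \<in> borel_measurable borel" by measurable
    qed
  next
    show "AE y in mu a. (\<Sum>i\<in>S. h' i y) + ?v y = - (f y * F (q y) + U y * (4 * q y * F2 (q y) + 2 * (real CARD('n) + 1 + a) * F1 (q y)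
      - (16 * (snd x)\<^sup>2 * (\<tau> * (1 - \<tau>)) * F2 (q y) + 2 * a * (snd x / snd y) * (1 - 2 * \<tau>) * F1 (q y))))"
      using AE_mu by eventually_elim (rule pt)
  qed (unfold measurable_cong_sets[OF sets_mu refl], measurable)
  with total show ?thesis by (simp only: Bochner_Integration.integral_minus neg_equal_0_iff_equal)
qed

lemma continuous_on_qf: "continuous_on UNIV (\<lambda>z. qf x (fst z) (snd z))"
  unfolding qf_eq by (intro continuous_intros)

text \<open>
  For fixed \<open>\<tau>\<close> the operator applied to \<open>F (qf x y \<tau>)\<close> is not a function of \<open>qf x y \<tau>\<close> alone; the excess is
  the \<open>\<tau>\<close>-derivative of \<open>4 (snd x / snd y) (\<tau> (1 - \<tau>)) powr (a / 2) F' (qf x y \<tau>)\<close> and integrates to zero.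
\<close>

lemma integral_om_total_derivative:
  fixes x y :: "(real^'n::finite) \<times> real"
  assumes a: "a > 0" and y: "y \<in> half_space"
    and F2: "\<And>z. (F1 has_real_derivative F2 z) (at z)"
    and cF2: "continuous_on UNIV F2"
  shows "(LINT \<tau>|om a. 16 * (snd x)\<^sup>2 * (\<tau> * (1 - \<tau>)) * F2 (qf x y \<tau>)
           + 2 * a * (snd x / snd y) * (1 - 2 * \<tau>) * F1 (qf x y \<tau>)) = 0"
proof -
  have t: "snd y > 0" using y by (simp add: half_space_def)
  have cF1: "continuous_on UNIV F1"
    by (rule DERIV_continuous_on, rule has_field_derivative_at_within, rule F2)
  define br where "br \<tau> = 16 * (snd x)\<^sup>2 * (\<tau> * (1 - \<tau>)) * F2 (qf x y \<tau>)
           + 2 * a * (snd x / snd y) * (1 - 2 * \<tau>) * F1 (qf x y \<tau>)" for \<tau>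
  have cq: "continuous_on UNIV (qf x y)" unfolding qf_eq[abs_def] by (intro continuous_intros)
  have cbr: "continuous_on UNIV br"
    unfolding br_def by (intro continuous_intros continuous_on_compose2[OF cF1 cq] continuous_on_compose2[OF cF2 cq] subset_UNIV)
  have [measurable]: "br \<in> borel_measurable borel" using cbr by (rule borel_measurable_continuous_onI)
  have "compact (br ` {0..1})" by (intro compact_continuous_image continuous_on_subset[OF cbr]) auto
  then obtain B where B: "\<And>\<tau>. \<tau> \<in> {0..1} \<Longrightarrow> norm (br \<tau>) \<le> B"
    by (force dest!: compact_imp_bounded simp: bounded_iff)
  interpret finite_measure "om a" by (rule finite_om[OF a])
  have "integrable (om a) br"
    by (intro integrable_const_bound[where B = B] eventually_mono[OF AE_om] B) auto
  then have i: "integrable lborel (\<lambda>\<tau>. indicator {0..1} \<tau> * (\<tau> * (1 - \<tau>)) powr (a / 2 - 1) * br \<tau>)"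
    by (subst (asm) integral_om) auto
  let ?g = "\<lambda>\<tau>. (\<tau> * (1 - \<tau>)) powr (a / 2 - 1) * br \<tau>"
  let ?G = "\<lambda>\<tau>. 4 * (snd x / snd y) * ((\<tau> * (1 - \<tau>)) powr (a / 2) * F1 (qf x y \<tau>))"
  \<comment> \<open>For small \<open>a\<close> the power \<open>a / 2\<close> is not differentiable
    at 0 and 1, but \<open>?G\<close> is continuous there and vanishes at both ends.\<close>
  have "(?g has_integral (?G 1 - ?G 0)) {0..1}"
  proof (rule fundamental_theorem_of_calculus_interior)
    show "continuous_on {0..1} ?G"
      using a by (intro continuous_intros continuous_on_powr' continuous_on_compose2[OF cF1 continuous_on_subset[OF cq]]) auto
    fix \<tau> :: real assume "\<tau> \<in> {0<..<1}"
    then have \<tau>: "\<tau> * (1 - \<tau>) > 0" by simp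
    define W where "W = (\<tau> * (1 - \<tau>)) powr (a / 2 - 1)"
    have p: "(\<tau> * (1 - \<tau>)) powr (a / 2) = (\<tau> * (1 - \<tau>)) * W"
      using \<tau> by (simp add: W_def powr_diff)
    have d1: "((\<lambda>\<tau>. (\<tau> * (1 - \<tau>)) powr (a / 2)) has_real_derivative
        (a / 2) * (1 - 2 * \<tau>) * (\<tau> * (1 - \<tau>)) powr (a / 2 - 1)) (at \<tau>)"
      using \<tau> by (auto intro!: derivative_eq_intros simp: powr_diff field_simps)
    have d2: "((\<lambda>\<tau>. F1 (qf x y \<tau>)) has_real_derivative F2 (qf x y \<tau>) * (4 * snd x * snd y)) (at \<tau>)"
      unfolding qf_eq by (rule DERIV_chain2[OF F2]) (auto intro!: derivative_eq_intros)
    have "(?G has_real_derivative ?g \<tau>) (at \<tau>)"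
      by (rule DERIV_cong[OF DERIV_cmult[OF DERIV_mult[OF d1 d2]]])
         (unfold p br_def W_def[symmetric], use t in \<open>simp add: power2_eq_square field_simps\<close>)
    then show "(?G has_vector_derivative ?g \<tau>) (at \<tau>)"
      by (simp add: has_real_derivative_iff_has_vector_derivative)
  qed simp
  then have "integral {0..1} ?g = 0" by (simp add: integral_unique)
  moreover have "(LINT \<tau>:{0..1}|lborel. ?g \<tau>) = integral {0..1} ?g"
    using i by (intro set_borel_integral_eq_integral) (simp add: set_integrable_def mult.assoc)
  moreover have "integral\<^sup>L (om a) br = (LINT \<tau>:{0..1}|lborel. ?g \<tau>)"
    by (subst integral_om) (auto simp: set_lebesgue_integral_def mult.assoc)
  ultimately show ?thesis unfolding br_def by simp
qed

text \<open>Averages \<open>weighted_green_fixed\<close> over \<tau>, with Fubini used in both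
  orders: the full integrand vanishes after integration in \<open>y\<close> for each \<tau>, the
  excess after integration in \<tau> for each \<open>y\<close>. Both orders rest on joint
  integrability, and the excess may grow like \<open>1 / snd y\<close> at the boundary, which the
  criterion allows.\<close>

lemma weighted_green:
  fixes U f :: "(real^'n::finite) \<times> real \<Rightarrow> real" and g gg :: "(real^'n) \<times> real \<Rightarrow> (real^'n) \<times> real \<Rightarrow> real"
    and x :: "(real^'n) \<times> real"
  assumes a: "a > 0"
    and cU: "continuous_on UNIV U"
    and cg: "\<And>i. i \<in> Basis \<Longrightarrow> continuous_on UNIV (g i)"
    and cgg: "\<And>i. i \<in> Basis \<Longrightarrow> continuous_on UNIV (gg i)"
    and dU: "\<And>i y. i \<in> Basis \<Longrightarrow> y \<in> half_space \<Longrightarrow> ((\<lambda>t. U (y + t *\<^sub>R i)) has_real_derivative g i y) (at 0)"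
    and dg: "\<And>i y. i \<in> Basis \<Longrightarrow> y \<in> half_space \<Longrightarrow> ((\<lambda>t. g i (y + t *\<^sub>R i)) has_real_derivative gg i y) (at 0)"
    and eq: "\<And>y. y \<in> half_space \<Longrightarrow> (\<Sum>i\<in>Basis. gg i y) + a / snd y * g (0, 1) y = - f y"
    and fm [measurable]: "f \<in> borel_measurable borel"
    and F1: "\<And>z. (F has_real_derivative F1 z) (at z)"
    and F2: "\<And>z. (F1 has_real_derivative F2 z) (at z)"
    and cF2: "continuous_on UNIV F2"
    and F0: "\<And>z. z \<ge> M \<Longrightarrow> F z = 0 \<and> F1 z = 0 \<and> F2 z = 0"
    and bU: "\<And>y. y \<in> half_space \<Longrightarrow> \<bar>U y\<bar> \<le> BU"
    and bf: "\<And>y. y \<in> half_space \<Longrightarrow> \<bar>f y\<bar> \<le> Bf"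
  shows "(LINT (y, \<tau>)|(nu a). f y * F (qf x y \<tau>) +
      U y * (4 * qf x y \<tau> * F2 (qf x y \<tau>) + 2 * (real CARD('n) + 1 + a) * F1 (qf x y \<tau>))) = 0"
proof -
  have cF: "continuous_on UNIV F" and cF1: "continuous_on UNIV F1"
    by (rule DERIV_continuous_on, rule has_field_derivative_at_within, rule F1 F2)+
  define L where "L z = 4 * z * F2 z + 2 * (real CARD('n) + 1 + a) * F1 z" for z
  define br where "br y \<tau> = 16 * (snd x)\<^sup>2 * (\<tau> * (1 - \<tau>)) * F2 (qf x y \<tau>)
           + 2 * a * (snd x / snd y) * (1 - 2 * \<tau>) * F1 (qf x y \<tau>)" for y \<tau>
  have cL: "continuous_on UNIV L"
    unfolding L_def by (intro continuous_intros cF2 cF1)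
  have [measurable]: "F \<in> borel_measurable borel" "F1 \<in> borel_measurable borel" "F2 \<in> borel_measurable borel"
    "L \<in> borel_measurable borel" "U \<in> borel_measurable borel"
    "(\<lambda>z. qf x (fst z) (snd z)) \<in> borel_measurable borel"
    using cF cF1 cF2 cL cU continuous_on_qf[of x] by (auto intro: borel_measurable_continuous_onI)
  \<comment> \<open>Bounds on the nonnegative axis suffice, since \<open>qf\<close> is nonnegative
    for \<tau> in [0, 1]; on the negative axis the truncated profiles are polynomials and
    unbounded.\<close>
  have bd: "\<exists>K\<ge>0. \<forall>z\<ge>0. \<bar>H z\<bar> \<le> K" if "continuous_on UNIV H" "\<And>z. z \<ge> M \<Longrightarrow> H z = 0" for H :: "real \<Rightarrow> real"
  proof -
    have "compact (H ` {0..\<bar>M\<bar>})" by (intro compact_continuous_image continuous_on_subset[OF that(1)]) auto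
    then obtain B where B: "\<And>z. z \<in> {0..\<bar>M\<bar>} \<Longrightarrow> norm (H z) \<le> B"
      by (force dest!: compact_imp_bounded simp: bounded_iff)
    have "\<bar>H z\<bar> \<le> max B 0" if "z \<ge> 0" for z
      using B[of z] that \<open>\<And>z. z \<ge> M \<Longrightarrow> H z = 0\<close>[of z] by (cases "z \<le> \<bar>M\<bar>") fastforce+
    then show ?thesis by (intro exI[of _ "max B 0"]) auto
  qed
  obtain K where K: "K \<ge> 0" "\<And>z. z \<ge> 0 \<Longrightarrow> \<bar>F z\<bar> \<le> K" using bd[OF cF] F0 by blast
  obtain K1 where K1: "K1 \<ge> 0" "\<And>z. z \<ge> 0 \<Longrightarrow> \<bar>F1 z\<bar> \<le> K1" using bd[OF cF1] F0 by blast
  obtain K2 where K2: "K2 \<ge> 0" "\<And>z. z \<ge> 0 \<Longrightarrow> \<bar>F2 z\<bar> \<le> K2" using bd[OF cF2] F0 by blast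
  obtain KL where KL: "KL \<ge> 0" "\<And>z. z \<ge> 0 \<Longrightarrow> \<bar>L z\<bar> \<le> KL" using bd[OF cL] F0 unfolding L_def by fastforce
  have qpos: "qf x y \<tau> \<ge> 0" if "\<tau> \<in> {0..1}" for y \<tau>
    using that by (simp add: qf_def)
  have "(0, 1) \<in> (half_space :: ((real^'n) \<times> real) set)" by (simp add: half_space_def)
  then have BU0: "BU \<ge> 0" and Bf0: "Bf \<ge> 0" using bU[of "(0, 1)"] bf[of "(0, 1)"] by linarith+
  define r where "r = norm x + sqrt \<bar>M\<bar>"
  have zero: "F (qf x y \<tau>) = 0 \<and> F1 (qf x y \<tau>) = 0 \<and> F2 (qf x y \<tau>) = 0" if "\<tau> \<in> {0..1}" "norm y > r" for y \<tau>
    using F0[OF qf_large[OF that(1), of x M y]] that(2) unfolding r_def by blast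
  let ?J = "\<lambda>z. f (fst z) * F (qf x (fst z) (snd z)) + U (fst z) * L (qf x (fst z) (snd z))"
  let ?B = "\<lambda>z. U (fst z) * br (fst z) (snd z)"
  have iJ: "integrable (nu a) ?J"
  proof (rule integrable_nu_bounded[OF a, where B = "Bf * K + BU * KL" and r = r])
    fix y :: "(real^'n) \<times> real" and \<tau> :: real
    assume y: "y \<in> half_space" and \<tau>: "\<tau> \<in> {0..1}"
    have "\<bar>?J (y, \<tau>)\<bar> \<le> Bf * K + BU * KL"
      using BU0 Bf0 K(1) KL(1) K(2)[OF qpos[OF \<tau>], of y] KL(2)[OF qpos[OF \<tau>], of y] bU[OF y] bf[OF y]
      by (intro order.trans[OF abs_triangle_ineq] add_mono) (auto simp: abs_mult intro!: mult_mono)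
    also have "\<dots> \<le> (Bf * K + BU * KL) * (1 + 1 / snd y)"
      using BU0 Bf0 K(1) KL(1) y by (intro le_one_plus_inverse_height) auto
    finally show "\<bar>?J (y, \<tau>)\<bar> \<le> (Bf * K + BU * KL) * (1 + 1 / snd y)" .
  qed (use zero in \<open>auto simp: L_def\<close>)
  have iB: "integrable (nu a) ?B"
  proof (rule integrable_nu_bounded[OF a, where B = "BU * (16 * (snd x)\<^sup>2 * K2 + 2 * a * \<bar>snd x\<bar> * K1)" and r = r])
    fix y :: "(real^'n) \<times> real" and \<tau> :: real
    assume y: "y \<in> half_space" and \<tau>: "\<tau> \<in> {0..1}"
    have t: "snd y > 0" using y by (simp add: half_space_def)
    have t1: "\<bar>\<tau> * (1 - \<tau>)\<bar> \<le> 1" "\<bar>1 - 2 * \<tau>\<bar> \<le> 1" using \<tau> by (auto simp: abs_mult intro!: mult_le_one)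
    have "\<bar>br y \<tau>\<bar> \<le> \<bar>16 * (snd x)\<^sup>2 * (\<tau> * (1 - \<tau>)) * F2 (qf x y \<tau>)\<bar> + \<bar>2 * a * (snd x / snd y) * (1 - 2 * \<tau>) * F1 (qf x y \<tau>)\<bar>"
      unfolding br_def by (rule abs_triangle_ineq)
    also have "\<dots> = 16 * (snd x)\<^sup>2 * \<bar>\<tau> * (1 - \<tau>)\<bar> * \<bar>F2 (qf x y \<tau>)\<bar> + 2 * a * (\<bar>snd x\<bar> / snd y) * \<bar>1 - 2 * \<tau>\<bar> * \<bar>F1 (qf x y \<tau>)\<bar>"
      using a t by (simp add: abs_mult)
    also have "\<dots> \<le> 16 * (snd x)\<^sup>2 * 1 * K2 + 2 * a * (\<bar>snd x\<bar> / snd y) * 1 * K1"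
      using a t t1 K1(1) K2(1) K1(2)[OF qpos[OF \<tau>], of y] K2(2)[OF qpos[OF \<tau>], of y] by (intro add_mono mult_mono mult_left_mono) auto
    also have "\<dots> \<le> (16 * (snd x)\<^sup>2 * K2 + 2 * a * \<bar>snd x\<bar> * K1) * (1 + 1 / snd y)"
      using t a K1(1) K2(1) by (simp add: field_simps)
    finally have b: "\<bar>br y \<tau>\<bar> \<le> (16 * (snd x)\<^sup>2 * K2 + 2 * a * \<bar>snd x\<bar> * K1) * (1 + 1 / snd y)" .
    have "\<bar>?B (y, \<tau>)\<bar> \<le> BU * ((16 * (snd x)\<^sup>2 * K2 + 2 * a * \<bar>snd x\<bar> * K1) * (1 + 1 / snd y))"
      unfolding abs_mult using BU0 bU[OF y] b by (intro mult_mono) auto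
    then show "\<bar>?B (y, \<tau>)\<bar> \<le> BU * (16 * (snd x)\<^sup>2 * K2 + 2 * a * \<bar>snd x\<bar> * K1) * (1 + 1 / snd y)"
      by (simp only: mult.assoc)
  next
    show "?B \<in> borel_measurable borel" unfolding br_def by measurable
  qed (use zero in \<open>auto simp: br_def\<close>)
  interpret mu: sigma_finite_measure "mu a :: ((real^'n) \<times> real) measure" by (rule sigma_finite_mu)
  interpret om: finite_measure "om a" by (rule finite_om[OF a])
  interpret pair_sigma_finite "mu a :: ((real^'n) \<times> real) measure" "om a" ..
  have B0: "integral\<^sup>L (nu a) ?B = 0"
  proof -
    have "integral\<^sup>L (nu a) ?B = (LINT y|mu a. LINT \<tau>|om a. ?B (y, \<tau>))"
      by (rule integral_fst'[OF iB, symmetric])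
    also have "\<dots> = (LINT y|(mu a :: ((real^'n) \<times> real) measure). 0)"
    proof (rule integral_cong_AE)
      show "(\<lambda>y. LINT \<tau>|om a. ?B (y, \<tau>)) \<in> borel_measurable (mu a)"
        by (rule borel_measurable_integrable[OF integrable_fst'[OF iB]])
      show "AE y in mu a. (LINT \<tau>|om a. ?B (y, \<tau>)) = 0"
        using AE_mu 
      proof eventually_elim
        case (elim y)
        have "(LINT \<tau>|om a. br y \<tau>) = 0"
          unfolding br_def by (rule integral_om_total_derivative[OF a elim F2 cF2])
        then show ?case by simp
      qed
    qed simp
    finally show ?thesis by simp
  qed
  have JB0: "integral\<^sup>L (nu a) (\<lambda>z. ?J z - ?B z) = 0"
  proof -
    have i: "integrable (nu a) (\<lambda>z. ?J z - ?B z)" using iJ iB by (rule Bochner_Integration.integrable_diff)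
    have i': "integrable (nu a) (case_prod (\<lambda>y \<tau>. ?J (y, \<tau>) - ?B (y, \<tau>)))"
      using i by (simp add: case_prod_beta')
    have "integral\<^sup>L (nu a) (\<lambda>z. ?J z - ?B z) = (LINT \<tau>|om a. LINT y|mu a. ?J (y, \<tau>) - ?B (y, \<tau>))"
      using integral_snd[OF i'] by (simp add: case_prod_beta')
    also have "\<dots> = (LINT \<tau>|om a. 0)"
    proof (rule integral_cong_AE)
      show "(\<lambda>\<tau>. LINT y|mu a. ?J (y, \<tau>) - ?B (y, \<tau>)) \<in> borel_measurable (om a)"
        by (rule borel_measurable_integrable[OF integrable_snd[OF i']])
      show "AE \<tau> in om a. (LINT y|mu a. ?J (y, \<tau>) - ?B (y, \<tau>)) = 0"
        using AE_om
      proof eventually_elim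
        case (elim \<tau>)
        show ?case
          using weighted_green_fixed[OF a cU cg cgg dU dg eq fm F1 F2 cF2 F0 elim, where x = x]
          by (simp only: br_def L_def right_diff_distrib fst_conv snd_conv add_diff_eq)
      qed
    qed simp
    finally show ?thesis by simp
  qed
  have "integral\<^sup>L (nu a) ?J = 0"
    using JB0 B0 Bochner_Integration.integral_diff[OF iJ iB] by simp
  then show ?thesis by (simp add: case_prod_beta' L_def)
qed

subsection \<open>Truncation of the fundamental solution\<close>

text \<open>
  The derivatives are required only inside the half space, but all functions are continuous on the
  whole space, so that a solution up to the boundary is first extended constantly below it.
\<close>

definition weighted_poisson :: "real \<Rightarrow> ((real^'n::finite) \<times> real \<Rightarrow> real) \<Rightarrow> ((real^'n) \<times> real \<Rightarrow> real) \<Rightarrow> bool" where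
  "weighted_poisson a U f \<longleftrightarrow> continuous_on UNIV U \<and> f \<in> borel_measurable borel \<and>
     (\<exists>g gg. (\<forall>i\<in>Basis. continuous_on UNIV (g i) \<and> continuous_on UNIV (gg i) \<and>
        (\<forall>y\<in>half_space. ((\<lambda>t. U (y + t *\<^sub>R i)) has_real_derivative g i y) (at 0) \<and>
           ((\<lambda>t. g i (y + t *\<^sub>R i)) has_real_derivative gg i y) (at 0))) \<and>
        (\<forall>y\<in>half_space. (\<Sum>i\<in>Basis. gg i y) + a / snd y * g (0, 1) y = - f y))"

text \<open>
  \<open>prof k\<close> continues \<open>z powr (- k)\<close> from \<open>z \<ge> 1\<close> by its second order Taylor polynomial at \<open>1\<close>. This keeps it
  twice continuously differentiable, and its weighted Laplacian is a multiple of \<open>max 0 (1 - z)\<close>.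
\<close>

definition prof :: "real \<Rightarrow> real \<Rightarrow> real" where
  "prof k z = (if z < 1 then 1 - k * (z - 1) + k * (k + 1) / 2 * (z - 1)\<^sup>2 else z powr (- k))"

definition prof1 :: "real \<Rightarrow> real \<Rightarrow> real" where
  "prof1 k z = (if z < 1 then - k + k * (k + 1) * (z - 1) else - k * z powr (- k - 1))"

definition prof2 :: "real \<Rightarrow> real \<Rightarrow> real" where
  "prof2 k z = (if z < 1 then k * (k + 1) else k * (k + 1) * z powr (- k - 2))"

lemma DERIV_glue:
  fixes p q :: "real \<Rightarrow> real"
  assumes p: "(p has_real_derivative D) (at c)" and q: "(q has_real_derivative D) (at c)" and e: "p c = q c"
  shows "((\<lambda>z. if z < c then p z else q z) has_real_derivative D) (at c)"
  unfolding has_field_derivative_iff filterlim_at_split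
proof
  have "((\<lambda>y. (p y - p c) / (y - c)) \<longlongrightarrow> D) (at_left c)"
    using p unfolding has_field_derivative_iff filterlim_at_split by blast
  then show "((\<lambda>y. ((if y < c then p y else q y) - (if c < c then p c else q c)) / (y - c)) \<longlongrightarrow> D) (at_left c)"
    by (rule Lim_transform_eventually) (auto simp: eventually_at_filter e)
  have "((\<lambda>y. (q y - q c) / (y - c)) \<longlongrightarrow> D) (at_right c)"
    using q unfolding has_field_derivative_iff filterlim_at_split by blast
  then show "((\<lambda>y. ((if y < c then p y else q y) - (if c < c then p c else q c)) / (y - c)) \<longlongrightarrow> D) (at_right c)"
    by (rule Lim_transform_eventually) (auto simp: eventually_at_filter e)
qed

text \<open>The right-hand piece is differentiated from \<open>c\<close> on, because it will be a
  power of \<open>z\<close> with derivative at positive arguments.\<close>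

lemma DERIV_piecewise:
  fixes p q :: "real \<Rightarrow> real"
  assumes p: "\<And>z. (p has_real_derivative p' z) (at z)"
    and q: "\<And>z. z \<ge> c \<Longrightarrow> (q has_real_derivative q' z) (at z)" 
    and e: "p c = q c" "p' c = q' c"
  shows "((\<lambda>z. if z < c then p z else q z) has_real_derivative (if z < c then p' z else q' z)) (at z)"
proof (cases z c rule: linorder_cases)
  case less
  then show ?thesis
    using has_field_derivative_transform_within_open[OF p[of z], of "{..<c}"] by auto
next
  case equal
  then show ?thesis using DERIV_glue[of p "q' c" c q] p[of c] q[of c] e by auto
next
  case greater
  then show ?thesis
    using has_field_derivative_transform_within_open[OF q[of z], of "{c<..}"] by auto
qed

lemma DERIV_prof: "(prof k has_real_derivative prof1 k z) (at z)"
  unfolding prof_def[abs_def] prof1_def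
proof (rule DERIV_piecewise)
  show "((\<lambda>z. 1 - k * (z - 1) + k * (k + 1) / 2 * (z - 1)\<^sup>2) has_real_derivative - k + k * (k + 1) * (z - 1)) (at z)" for z
    by (auto intro!: derivative_eq_intros simp: field_simps)
  show "((\<lambda>z. z powr (- k)) has_real_derivative - k * z powr (- k - 1)) (at z)" if "1 \<le> z" for z
    using that by (auto intro!: derivative_eq_intros)
qed auto

lemma DERIV_prof1: "(prof1 k has_real_derivative prof2 k z) (at z)"
  unfolding prof1_def[abs_def] prof2_def
proof (rule DERIV_piecewise)
  show "((\<lambda>z. - k + k * (k + 1) * (z - 1)) has_real_derivative k * (k + 1)) (at z)" for z
    by (auto intro!: derivative_eq_intros)
  show "((\<lambda>z. - k * z powr (- k - 1)) has_real_derivative k * (k + 1) * z powr (- k - 2)) (at z)" if "1 \<le> z" for z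
    using that by (auto intro!: derivative_eq_intros simp: algebra_simps)
qed auto

lemma continuous_on_prof2: "continuous_on UNIV (prof2 k)"
proof -
  have "prof2 k = (\<lambda>z. k * (k + 1) * (max z 1) powr (- k - 2))" by (auto simp: prof2_def max_def)
  then show ?thesis by (auto intro!: continuous_intros)
qed

text \<open>With z = r^2 this is the radial Laplacian in dimension 2 k + 2, for which r^(-2k) is
  harmonic away from 0. For z < 1 it is linear in \<open>z\<close>, and second order contact with
  the power makes it vanish at z = 1.\<close>

lemma prof_weighted_laplacian:
  "4 * z * prof2 k z + 4 * (k + 1) * prof1 k z = - (4 * k * (k + 1) * (k + 2) * max 0 (1 - z))"
proof (cases "z < 1")
  case False
  then have "z * z powr (- k - 2) = z powr (- k - 1)" by (simp add: powr_diff power2_eq_square)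
  have "4 * z * prof2 k z = 4 * k * (k + 1) * (z * z powr (- k - 2))"
    using False by (simp add: prof2_def)
  also note \<open>z * z powr (- k - 2) = z powr (- k - 1)\<close>
  finally show ?thesis using False by (simp add: prof1_def algebra_simps)
qed (simp add: prof1_def prof2_def algebra_simps)

text \<open>The parameter \<open>e\<close> is a squared radius. The scaling is the one that keeps
  \<open>q powr (- k)\<close> unchanged for q \<ge> e.\<close>

definition trunc :: "real \<Rightarrow> real \<Rightarrow> real \<Rightarrow> real" where
  "trunc k e q = e powr (- k) * prof k (q / e)"

text \<open>The negative of the weighted Laplacian of \<open>trunc k e\<close>: the smeared point
  source that replaces the pole. It is nonnegative and vanishes from q = e on, which makes integrals
  against it averages.\<close>

definition bump :: "real \<Rightarrow> real \<Rightarrow> real \<Rightarrow> real" where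
  "bump k e q = 4 * k * (k + 1) * (k + 2) * e powr (- k - 1) * max 0 (1 - q / e)"

lemma trunc_eq_powr:
  assumes "e > 0" "q \<ge> e"
  shows "trunc k e q = q powr (- k)"
  using assms by (simp add: trunc_def prof_def powr_mult[symmetric])

text \<open>The derivative in the squared radius has the sign of -(k p + z p') with p =
  \<open>prof k\<close> and z = q / e. The bracket is a multiple of (1 - z)^2 for z < 1 and zero
  beyond, so the truncations grow as the radius shrinks. Monotone convergence rests on this.\<close>

lemma trunc_antimono:
  assumes "k > 0" "q \<ge> 0" "0 < d" "d \<le> e"
  shows "trunc k e q \<le> trunc k d q"
proof (rule DERIV_nonpos_imp_nonincreasing[OF assms(4)])
  fix y assume "d \<le> y" "y \<le> e"
  then have y: "y > 0" using assms by simp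
  have main: "k * prof k z + z * prof1 k z \<ge> 0" if "z \<ge> 0" for z
  proof (cases "z < 1")
    case True
    have "k * prof k z + z * prof1 k z = k * (k + 1) * (k + 2) / 2 * (1 - z)\<^sup>2"
      using True by (simp add: prof_def prof1_def power2_eq_square field_simps)
    moreover have "0 \<le> k * (k + 1) * (k + 2) / 2 * (1 - z)\<^sup>2" using assms(1) by simp
    ultimately show ?thesis by linarith
  next
    case False
    then have "z * z powr (- k - 1) = z powr (- k)" by (simp add: powr_diff)
    then show ?thesis using False by (simp add: prof_def prof1_def algebra_simps)
  qed
  have "((\<lambda>e. trunc k e q) has_real_derivative
      (- k * y powr (- k - 1)) * prof k (q / y) + prof1 k (q / y) * (- (q / y\<^sup>2)) * y powr (- k)) (at y)"
    unfolding trunc_def using y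
    by (intro DERIV_mult DERIV_chain2[OF DERIV_prof])
       (auto intro!: derivative_eq_intros simp: power2_eq_square)
  moreover have "(- k * y powr (- k - 1)) * prof k (q / y) + prof1 k (q / y) * (- (q / y\<^sup>2)) * y powr (- k)
     = - (y powr (- k - 1) * (k * prof k (q / y) + (q / y) * prof1 k (q / y)))"
    using y by (simp add: powr_diff field_simps power2_eq_square)
  moreover have "\<dots> \<le> 0" using main[of "q / y"] y assms by simp
  ultimately show "\<exists>D. ((\<lambda>e. trunc k e q) has_real_derivative D) (at y) \<and> D \<le> 0" by auto
qed

lemma tendsto_trunc_0:
  assumes "k > 0" "q > 0"
  shows "(\<lambda>j. trunc k (1 / real (Suc j)) q) \<longlonglongrightarrow> q powr (- k)"
proof (rule tendsto_eventually)
  have "(\<lambda>j. 1 / real (Suc j)) \<longlonglongrightarrow> 0" by (rule LIMSEQ_Suc[OF lim_1_over_n])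
  then have "eventually (\<lambda>j. 1 / real (Suc j) < q) sequentially" using assms(2) by (rule order_tendstoD(2))
  then show "eventually (\<lambda>j. trunc k (1 / real (Suc j)) q = q powr (- k)) sequentially"
    by eventually_elim (intro trunc_eq_powr, auto)
qed

lemma tendsto_trunc_top:
  assumes "k > 0"
  shows "(\<lambda>j. trunc k (real (Suc j)) q) \<longlonglongrightarrow> 0"
proof -
  have S: "filterlim (\<lambda>j. real (Suc j)) at_top sequentially"
    by (rule filterlim_compose[OF filterlim_real_sequentially filterlim_Suc])
  have "(\<lambda>j. real (Suc j) powr (- k)) \<longlonglongrightarrow> 0"
    using assms by (intro tendsto_neg_powr S) auto
  moreover have "(\<lambda>j. prof k (q / real (Suc j))) \<longlonglongrightarrow> prof k 0"
  proof (rule isCont_tendsto_compose[of _ "prof k"])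
    show "isCont (prof k) 0" by (rule DERIV_isCont[OF DERIV_prof])
    show "(\<lambda>j. q / real (Suc j)) \<longlonglongrightarrow> 0"
      by (rule tendsto_divide_0[OF tendsto_const]) (rule filterlim_at_top_imp_at_infinity[OF S])
  qed
  ultimately have "(\<lambda>j. real (Suc j) powr (- k) * prof k (q / real (Suc j))) \<longlonglongrightarrow> 0 * prof k 0"
    by (rule tendsto_mult)
  then show ?thesis by (simp add: trunc_def)
qed

lemma bump_nonneg: "k > 0 \<Longrightarrow> bump k e q \<ge> 0"
  by (simp add: bump_def)

lemma bump_le: "k > 0 \<Longrightarrow> e > 0 \<Longrightarrow> q \<ge> 0 \<Longrightarrow> bump k e q \<le> 4 * k * (k + 1) * (k + 2) * e powr (- k - 1)"
  unfolding bump_def by (intro mult_left_le) auto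

lemma bump_zero: "e > 0 \<Longrightarrow> q \<ge> e \<Longrightarrow> bump k e q = 0"
  by (simp add: bump_def)

lemma bump_borel [measurable]: "bump k e \<in> borel_measurable borel"
  unfolding bump_def[abs_def] by measurable

lemma trunc_borel [measurable]: "trunc k e \<in> borel_measurable borel"
  unfolding trunc_def[abs_def] prof_def[abs_def] by measurable

lemma qf_borel [measurable]: "(\<lambda>z. qf x (fst z) (snd z)) \<in> borel_measurable borel"
  by (rule borel_measurable_continuous_onI[OF continuous_on_qf])

lemma qf_nonneg: "\<tau> \<in> {0..1} \<Longrightarrow> qf x y \<tau> \<ge> 0"
  by (simp add: qf_def)

section \<open>Green's identity for the truncations\<close>

lemma integrable_nu_radial:
  fixes h :: "(real^'n::finite) \<times> real \<Rightarrow> real"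
  assumes "a > 0" and [measurable]: "h \<in> borel_measurable borel" "H \<in> borel_measurable borel"
    and h: "\<And>y. y \<in> half_space \<Longrightarrow> \<bar>h y\<bar> \<le> B"
    and H: "\<And>z. z \<ge> 0 \<Longrightarrow> \<bar>H z\<bar> \<le> K" "\<And>z. z \<ge> M \<Longrightarrow> H z = 0"
  shows "integrable (nu a) (\<lambda>z. h (fst z) * H (qf x (fst z) (snd z)))"
proof (rule integrable_nu_bounded[OF assms(1), where B = "B * K" and r = "norm x + sqrt \<bar>M\<bar>"])
  have "(0, 1) \<in> (half_space :: ((real^'n) \<times> real) set)" by (simp add: half_space_def)
  then have B: "B \<ge> 0" using h[of "(0, 1)"] by linarith
  have K: "K \<ge> 0" using H(1)[of 0] by linarith
  fix y :: "(real^'n) \<times> real" and \<tau> :: real assume y: "y \<in> half_space" and \<tau>: "\<tau> \<in> {0..1}"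
  have "\<bar>h y * H (qf x y \<tau>)\<bar> \<le> B * K"
    using h[OF y] H(1)[OF qf_nonneg[OF \<tau>], of x y] B K by (auto simp: abs_mult intro!: mult_mono)
  also have "\<dots> \<le> B * K * (1 + 1 / snd y)"
    using B K y by (intro le_one_plus_inverse_height) auto
  finally show "\<bar>h (fst (y, \<tau>)) * H (qf x (fst (y, \<tau>)) (snd (y, \<tau>)))\<bar> \<le> B * K * (1 + 1 / snd y)" by simp
  show "h (fst (y, \<tau>)) * H (qf x (fst (y, \<tau>)) (snd (y, \<tau>))) = 0" if "norm y > norm x + sqrt \<bar>M\<bar>"
    using H(2)[OF qf_large[OF \<tau> that]] by simp
qed measurable

text \<open>Both truncations equal \<open>q powr (- k)\<close> for q \<ge> e, so their difference is
  an admissible test function with M = e. Its weighted Laplacian is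
  \<open>bump k e - bump k d\<close>, which turns Green's formula into a difference of two averages
  of \<open>U\<close>.\<close>

lemma truncated_representation:
  fixes U f :: "(real^'n::finite) \<times> real \<Rightarrow> real"
  assumes a: "a > 0" and k: "k = (real CARD('n) + a - 1) / 2" "k > 0"
    and sol: "weighted_poisson a U f"
    and bU: "\<And>y. y \<in> half_space \<Longrightarrow> \<bar>U y\<bar> \<le> BU"
    and bf: "\<And>y. y \<in> half_space \<Longrightarrow> \<bar>f y\<bar> \<le> Bf"
    and d: "0 < d" "d \<le> e"
  defines "\<nu> \<equiv> nu a"
  shows "(LINT z|\<nu>. f (fst z) * (trunc k d (qf x (fst z) (snd z)) - trunc k e (qf x (fst z) (snd z)))) =
      (LINT z|\<nu>. U (fst z) * bump k d (qf x (fst z) (snd z))) - (LINT z|\<nu>. U (fst z) * bump k e (qf x (fst z) (snd z)))"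
    and "integrable \<nu> (\<lambda>z. f (fst z) * (trunc k d (qf x (fst z) (snd z)) - trunc k e (qf x (fst z) (snd z))))"
proof -
  have cU: "continuous_on UNIV U" and fm [measurable]: "f \<in> borel_measurable borel"
    using sol by (auto simp: weighted_poisson_def)
  have [measurable]: "U \<in> borel_measurable borel" using cU by (rule borel_measurable_continuous_onI)
  obtain g gg where g: "\<And>i. i \<in> Basis \<Longrightarrow> continuous_on UNIV (g i)" "\<And>i. i \<in> Basis \<Longrightarrow> continuous_on UNIV (gg i)"
    "\<And>i y. i \<in> Basis \<Longrightarrow> y \<in> half_space \<Longrightarrow> ((\<lambda>t. U (y + t *\<^sub>R i)) has_real_derivative g i y) (at 0)"
    "\<And>i y. i \<in> Basis \<Longrightarrow> y \<in> half_space \<Longrightarrow> ((\<lambda>t. g i (y + t *\<^sub>R i)) has_real_derivative gg i y) (at 0)"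
    "\<And>y. y \<in> half_space \<Longrightarrow> (\<Sum>i\<in>Basis. gg i y) + a / snd y * g (0, 1) y = - f y"
    using sol unfolding weighted_poisson_def by blast
  define T1 where "T1 e q = e powr (- k - 1) * prof1 k (q / e)" for e q
  define T2 where "T2 e q = e powr (- k - 2) * prof2 k (q / e)" for e q
  have dT: "(trunc k e has_real_derivative T1 e q) (at q)" "(T1 e has_real_derivative T2 e q) (at q)" if "e > 0" for e q
  proof -
    have dq: "((\<lambda>q. q / e) has_real_derivative 1 / e) (at q)"
      using that by (auto intro!: derivative_eq_intros)
    show "(trunc k e has_real_derivative T1 e q) (at q)"
      unfolding trunc_def[abs_def] T1_def
      by (rule DERIV_cong[OF DERIV_cmult[OF DERIV_chain2[OF DERIV_prof dq]]]) (use that in \<open>simp add: powr_diff\<close>)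
    show "(T1 e has_real_derivative T2 e q) (at q)"
      unfolding T1_def[abs_def] T2_def
      by (rule DERIV_cong[OF DERIV_cmult[OF DERIV_chain2[OF DERIV_prof1 dq]]])
        (use that in \<open>simp add: powr_diff power2_eq_square\<close>)
  qed
  have Lap: "4 * q * T2 e q + 4 * (k + 1) * T1 e q = - bump k e q" if "e > 0" for e q
  proof -
    have "4 * q * T2 e q + 4 * (k + 1) * T1 e q = e powr (- k - 1) * (4 * (q / e) * prof2 k (q / e) + 4 * (k + 1) * prof1 k (q / e))"
      using that by (simp add: T1_def T2_def powr_diff power2_eq_square field_simps)
    also have "\<dots> = - bump k e q" unfolding prof_weighted_laplacian by (simp add: bump_def)
    finally show ?thesis .
  qed
  \<comment> \<open>Beyond the truncation nothing depends on the radius, so the two functions cancel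
    together with their first two derivatives.\<close>
  have T_outside: "trunc k e q = q powr (- k) \<and> T1 e q = - k * q powr (- k - 1) \<and> T2 e q = k * (k + 1) * q powr (- k - 2)"
    if "e > 0" "q \<ge> e" for e q
    using that trunc_eq_powr[OF that, of k]
    by (simp add: T1_def T2_def prof1_def prof2_def powr_divide powr_minus field_simps)
  have e: "e > 0" using d by simp
  have cT2: "continuous_on UNIV (T2 e)" for e
    unfolding T2_def[abs_def] divide_inverse
    by (intro continuous_intros continuous_on_compose2[OF continuous_on_prof2]) auto
  let ?F = "\<lambda>q. trunc k d q - trunc k e q"
  let ?q = "\<lambda>z. qf x (fst z) (snd z)"
  have main: "(LINT (y, \<tau>)|\<nu>. f y * ?F (qf x y \<tau>) +
      U y * (4 * qf x y \<tau> * (T2 d (qf x y \<tau>) - T2 e (qf x y \<tau>)) + 2 * (real CARD('n) + 1 + a) * (T1 d (qf x y \<tau>) - T1 e (qf x y \<tau>)))) = 0"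
    unfolding \<nu>_def
    by (rule weighted_green[OF a cU g fm _ _ _ _ bU bf, where M = e])
      (use d e T_outside[of d] T_outside[of e] in \<open>auto intro!: DERIV_diff dT continuous_on_diff cT2\<close>)
  \<comment> \<open>This fixes the exponent: the dimension n + 1 + a equals 2 k + 2, in which
    \<open>q powr (- k)\<close> is harmonic off the pole.\<close>
  have N: "2 * (real CARD('n) + 1 + a) = 4 * (k + 1)" using k by simp
  have pt: "f (fst z) * ?F (?q z) + U (fst z) * (4 * ?q z * (T2 d (?q z) - T2 e (?q z)) + 2 * (real CARD('n) + 1 + a) * (T1 d (?q z) - T1 e (?q z)))
      = f (fst z) * ?F (?q z) - (U (fst z) * bump k d (?q z) - U (fst z) * bump k e (?q z))" for z
  proof -
    have L: "4 * ?q z * (T2 d (?q z) - T2 e (?q z)) + 4 * (k + 1) * (T1 d (?q z) - T1 e (?q z)) = - bump k d (?q z) + bump k e (?q z)"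
      using Lap[OF d(1), of "?q z"] Lap[OF e, of "?q z"] by (simp add: algebra_simps)
    show ?thesis unfolding N L by (simp add: algebra_simps)
  qed
  have ib: "integrable \<nu> (\<lambda>z. U (fst z) * bump k e (?q z))" if "e > 0" for e
    unfolding \<nu>_def
    by (rule integrable_nu_radial[OF a _ _ bU, where K = "4 * k * (k + 1) * (k + 2) * e powr (- k - 1)" and M = e])
      (use that k(2) bump_nonneg bump_le bump_zero in auto)
  have "compact (?F ` {0..e})"
    using dT[OF d(1)] dT[OF e] by (intro compact_continuous_image continuous_intros DERIV_continuous_on)
       (auto intro: has_field_derivative_at_within)
  then obtain B where B: "\<And>q. q \<in> {0..e} \<Longrightarrow> norm (?F q) \<le> B"
    by (force dest!: compact_imp_bounded simp: bounded_iff)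
  have F0: "?F q = 0" if "q \<ge> e" for q using that d trunc_eq_powr by auto
  have FB: "\<bar>?F q\<bar> \<le> max B 0" if "q \<ge> 0" for q
    using B[of q] F0[of q] that by (cases "q \<le> e") force+
  show int: "integrable \<nu> (\<lambda>z. f (fst z) * ?F (?q z))"
    unfolding \<nu>_def by (rule integrable_nu_radial[OF a _ _ bf FB F0]) auto
  show "(LINT z|\<nu>. f (fst z) * ?F (?q z)) = (LINT z|\<nu>. U (fst z) * bump k d (?q z)) - (LINT z|\<nu>. U (fst z) * bump k e (?q z))"
  proof -
    have "(LINT z|\<nu>. f (fst z) * ?F (?q z) - (U (fst z) * bump k d (?q z) - U (fst z) * bump k e (?q z))) = 0"
      using main unfolding case_prod_beta' pt .
    then show ?thesis using int ib[OF d(1)] ib[OF e] by simp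
  qed
qed

subsection \<open>Removal of the truncation\<close>

lemma integral_mu_scale:
  fixes h :: "(real^'n::finite) \<times> real \<Rightarrow> real"
  assumes \<rho>: "\<rho> > 0" and [measurable]: "h \<in> borel_measurable borel"
  shows "integral\<^sup>L (mu a) h = \<rho> powr (real CARD('n) + 1 + a) * integral\<^sup>L (mu a) (\<lambda>y. h (\<rho> *\<^sub>R y))"
proof -
  let ?K = "\<lambda>y. indicator half_space y * snd y powr a * h y"
  have "integral\<^sup>L (mu a) h = (LINT y|lborel. ?K y)" by (rule integral_mu) measurable
  also have "\<dots> = (LINT y|density (distr lborel borel (\<lambda>y::(real^'n) \<times> real. 0 + \<rho> *\<^sub>R y)) (\<lambda>_. \<bar>\<rho>\<bar> ^ DIM((real^'n) \<times> real)). ?K y)"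
    using lborel_affine[of \<rho> "0 :: (real^'n) \<times> real"] \<rho> by simp
  also have "\<dots> = (LINT y|lborel. \<rho> ^ DIM((real^'n) \<times> real) * ?K (\<rho> *\<^sub>R y))"
    using \<rho> by (subst integral_density) (auto simp: integral_distr)
  also have "\<dots> = (LINT y|lborel. \<rho> powr (real CARD('n) + 1 + a) * (indicator half_space y * snd y powr a * h (\<rho> *\<^sub>R y)))"
    using \<rho> by (intro Bochner_Integration.integral_cong)
      (auto simp: half_space_def indicator_def powr_mult powr_add powr_realpow zero_less_mult_iff)
  also have "\<dots> = \<rho> powr (real CARD('n) + 1 + a) * integral\<^sup>L (mu a) (\<lambda>y. h (\<rho> *\<^sub>R y))"
    by (subst integral_mu) auto
  finally show ?thesis .
qed

lemma qf_scale:
  assumes "\<rho> > 0"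
  shows "qf x (\<rho> *\<^sub>R y) \<tau> = \<rho>\<^sup>2 * qf ((1 / \<rho>) *\<^sub>R x) y \<tau>"
proof -
  have "x - \<rho> *\<^sub>R y = \<rho> *\<^sub>R ((1 / \<rho>) *\<^sub>R x - y)" using assms by (simp add: scaleR_diff_right)
  then have "norm (x - \<rho> *\<^sub>R y) = \<rho> * norm ((1 / \<rho>) *\<^sub>R x - y)" using assms by simp
  then show ?thesis using assms by (simp add: qf_eq power_mult_distrib power2_eq_square field_simps)
qed

lemma bump_scale: "R > 0 \<Longrightarrow> bump k R (R * z) = R powr (- k - 1) * bump k 1 z"
  by (simp add: bump_def)

lemma AE_nu:
  assumes "a > 0"
  shows "AE z in (nu a :: (((real^'n::finite) \<times> real) \<times> real) measure). fst z \<in> half_space \<and> snd z \<in> {0..1} \<and> fst z \<noteq> x"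
proof -
  interpret mu: sigma_finite_measure "mu a :: ((real^'n) \<times> real) measure" by (rule sigma_finite_mu)
  interpret om: finite_measure "om a" by (rule finite_om[OF assms])
  interpret pair_sigma_finite "mu a :: ((real^'n) \<times> real) measure" "om a" ..
  have [measurable]: "{x} \<in> sets borel" by simp
  show ?thesis
  proof (rule AE_pair_measure)
    have "AE y in mu a. y \<in> half_space \<and> y \<noteq> x"
      using AE_mu AE_mu_neq[of x a] by eventually_elim auto
    then show "AE y in mu a. AE \<tau> in om a. fst (y, \<tau>) \<in> half_space \<and> snd (y, \<tau>) \<in> {0..1} \<and> fst (y, \<tau>) \<noteq> x"
    proof eventually_elim
      case (elim y)
      show ?case using AE_om by eventually_elim (use elim in auto)
    qed
    have "{z::((real^'n) \<times> real) \<times> real. fst z \<in> half_space \<and> snd z \<in> {0..1} \<and> fst z \<notin> {x}} \<in> sets borel"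
      by measurable
    then show "{z \<in> space (nu a). fst z \<in> half_space \<and> snd z \<in> {0..1} \<and> fst z \<noteq> x} \<in> sets (nu a)"
      by (simp add: space_pair_measure borel_prod[symmetric] cong: sets_pair_measure_cong)
  qed
qed

lemma borel_measurable_nu: "borel_measurable ((nu a :: (((real^'n::finite) \<times> real) \<times> real) measure)) = borel_measurable borel"
proof (rule measurable_cong_sets)
  show "sets ((nu a :: (((real^'n::finite) \<times> real) \<times> real) measure)) = sets borel"
    by (simp add: borel_prod[symmetric] cong: sets_pair_measure_cong)
qed simp

lemma integrable_bump:
  fixes U :: "(real^'n::finite) \<times> real \<Rightarrow> real"
  assumes "a > 0" "k > 0" "R > 0" "U \<in> borel_measurable borel"
    and "\<And>y. y \<in> half_space \<Longrightarrow> \<bar>U y\<bar> \<le> BU"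
  shows "integrable (nu a) (\<lambda>z. U (fst z) * bump k R (qf x (fst z) (snd z)))"
  by (rule integrable_nu_radial[OF assms(1,4) _ assms(5), where K = "4 * k * (k + 1) * (k + 2) * R powr (- k - 1)" and M = R])
    (use assms(2,3) bump_nonneg bump_le bump_zero in auto)

text \<open>Dilation by \<open>sqrt R\<close> multiplies \<open>mu a\<close> by
  \<open>R powr (k + 1)\<close> and the bump by \<open>R powr (- k - 1)\<close>, so the factors
  cancel. An average at squared radius R becomes one at radius 1, with dilated \<open>U\<close> and
  the pole moved to x / sqrt R.\<close>

lemma integral_bump_scale:
  fixes U :: "(real^'n::finite) \<times> real \<Rightarrow> real"
  assumes a: "a > 0" and k: "k = (real CARD('n) + a - 1) / 2" "k > 0" and R: "R > 0"
    and Um [measurable]: "U \<in> borel_measurable borel"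
    and bU: "\<And>y. y \<in> half_space \<Longrightarrow> \<bar>U y\<bar> \<le> BU"
  shows "(LINT z|nu a. U (fst z) * bump k R (qf x (fst z) (snd z))) =
    (LINT z|nu a. U (sqrt R *\<^sub>R fst z) * bump k 1 (qf ((1 / sqrt R) *\<^sub>R x) (fst z) (snd z)))"
proof -
  interpret mu: sigma_finite_measure "mu a :: ((real^'n) \<times> real) measure" by (rule sigma_finite_mu)
  interpret om: finite_measure "om a" by (rule finite_om[OF a])
  interpret pair_sigma_finite "mu a :: ((real^'n) \<times> real) measure" "om a" ..
  have i1: "integrable (nu a) (\<lambda>z. U (fst z) * bump k R (qf x (fst z) (snd z)))"
    by (rule integrable_bump[OF a k(2) R Um bU])
  have bU': "\<bar>U (sqrt R *\<^sub>R y)\<bar> \<le> BU" if "y \<in> half_space" for y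
    using that R by (intro bU) (auto simp: half_space_def)
  have i2: "integrable (nu a) (\<lambda>z. U (sqrt R *\<^sub>R fst z) * bump k 1 (qf ((1 / sqrt R) *\<^sub>R x) (fst z) (snd z)))"
    by (rule integrable_bump[OF a k(2) _ _ bU']) auto
  let ?H = "\<lambda>y. LINT \<tau>|om a. U (fst (y, \<tau>)) * bump k R (qf x (fst (y, \<tau>)) (snd (y, \<tau>)))"
  have Hm: "?H \<in> borel_measurable borel"
    using borel_measurable_integrable[OF integrable_fst'[OF i1]] by (simp add: measurable_cong_sets[OF sets_mu refl])
  have pw: "sqrt R powr (real CARD('n) + 1 + a) = R powr (k + 1)"
  proof -
    have e: "real CARD('n) + 1 + a = 2 * (k + 1)" using k(1) by simp
    show ?thesis unfolding e using R by (simp add: powr_half_sqrt[symmetric] powr_powr add_divide_distrib)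
  qed
  have "(LINT z|nu a. U (fst z) * bump k R (qf x (fst z) (snd z))) = integral\<^sup>L (mu a) ?H"
    by (rule integral_fst'[OF i1, symmetric])
  also have "\<dots> = R powr (k + 1) * (LINT y|mu a. ?H (sqrt R *\<^sub>R y))"
    using integral_mu_scale[OF _ Hm, of "sqrt R"] R pw by simp
  also have "\<dots> = R powr (k + 1) * (LINT y|mu a. R powr (- k - 1) *
      (LINT \<tau>|om a. U (sqrt R *\<^sub>R y) * bump k 1 (qf ((1 / sqrt R) *\<^sub>R x) y \<tau>)))"
  proof -
    have "U (sqrt R *\<^sub>R y) * bump k R (qf x (sqrt R *\<^sub>R y) \<tau>) =
        R powr (- k - 1) * (U (sqrt R *\<^sub>R y) * bump k 1 (qf ((1 / sqrt R) *\<^sub>R x) y \<tau>))" for y \<tau>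
      using R by (simp add: qf_scale bump_scale del: times_divide_eq_left)
    then show ?thesis by (simp only: fst_conv snd_conv integral_mult_right_zero)
  qed
  also have "\<dots> = (LINT y|mu a. LINT \<tau>|om a. U (sqrt R *\<^sub>R y) * bump k 1 (qf ((1 / sqrt R) *\<^sub>R x) y \<tau>))"
  proof -
    have "R powr (k + 1) * R powr (- k - 1) = 1" using R by (simp add: powr_add[symmetric])
    then show ?thesis by (subst integral_mult_right_zero, subst mult.assoc[symmetric]) (simp only: mult_1_left)
  qed
  also have "\<dots> = (LINT z|nu a. U (sqrt R *\<^sub>R fst z) * bump k 1 (qf ((1 / sqrt R) *\<^sub>R x) (fst z) (snd z)))"
    using integral_fst'[OF i2] by simp
  finally show ?thesis .
qed

text \<open>The average of the constant 1 at radius 1 with the pole at the origin, where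
  \<open>qf\<close> reduces to the squared norm for every \<tau>.\<close>

definition bump_mass :: "'n::finite itself \<Rightarrow> real \<Rightarrow> real \<Rightarrow> real" where
  "bump_mass _ a k = (LINT z|(nu a :: (((real^'n) \<times> real) \<times> real) measure). bump k 1 ((norm (fst z))\<^sup>2))"

text \<open>After dilation the pole tends to the origin and the dilates of \<open>U\<close> tend to
  \<open>l\<close> at every point of the half space. The poles stay within distance
  \<open>norm x\<close> of the origin, so the ball of radius \<open>norm x + 1\<close> contains all
  supports and yields a majorant. The limit l = 0 serves the solution, l = 1 the constant
  function.\<close>

lemma tendsto_bump_top:
  fixes U :: "(real^'n::finite) \<times> real \<Rightarrow> real"
  assumes a: "a > 0" and k: "k = (real CARD('n) + a - 1) / 2" "k > 0"
    and Um [measurable]: "U \<in> borel_measurable borel"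
    and bU: "\<And>y. y \<in> half_space \<Longrightarrow> \<bar>U y\<bar> \<le> BU"
    and lim: "(U \<longlongrightarrow> l) (inf at_infinity (principal half_space))"
  shows "(\<lambda>j. LINT z|nu a. U (fst z) * bump k (real (Suc j)) (qf x (fst z) (snd z)))
    \<longlonglongrightarrow> l * bump_mass TYPE('n) a k"
proof -
  let ?R = "\<lambda>j. real (Suc j)"
  let ?B = "BU * (4 * k * (k + 1) * (k + 2))"
  have S: "filterlim ?R at_top sequentially"
    by (rule filterlim_compose[OF filterlim_real_sequentially filterlim_Suc])
  have sq: "filterlim (\<lambda>j. sqrt (?R j)) at_top sequentially"
    by (rule filterlim_compose[OF sqrt_at_top S])
  have "(0, 1) \<in> (half_space :: ((real^'n) \<times> real) set)" by (simp add: half_space_def)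
  then have BU: "BU \<ge> 0" using bU[of "(0, 1)"] by linarith
  have dom: "integrable (nu a) (\<lambda>z::((real^'n) \<times> real) \<times> real. indicator (cball 0 (norm x + 1)) (fst z) * ?B)"
  proof (rule integrable_nu_bounded[OF a, where B = ?B and r = "norm x + 1"])
    fix y :: "(real^'n) \<times> real" and \<tau> :: real assume y: "y \<in> half_space"
    have "\<bar>indicator (cball 0 (norm x + 1)) y * ?B\<bar> \<le> ?B"
      using BU k by (auto simp: indicator_def abs_mult)
    also have "\<dots> \<le> ?B * (1 + 1 / snd y)" using BU k y by (intro le_one_plus_inverse_height) auto
    finally show "\<bar>indicator (cball 0 (norm x + 1)) (fst (y, \<tau>)) * ?B\<bar> \<le> ?B * (1 + 1 / snd y)" by simp
  qed auto
  have "(\<lambda>j. LINT z|nu a. U (sqrt (?R j) *\<^sub>R fst z) * bump k 1 (qf ((1 / sqrt (?R j)) *\<^sub>R x) (fst z) (snd z)))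
     \<longlonglongrightarrow> (LINT z|(nu a :: (((real^'n) \<times> real) \<times> real) measure). l * bump k 1 ((norm (fst z))\<^sup>2))"
  proof (rule integral_dominated_convergence[OF _ _ dom])
    show "AE z in nu a. (\<lambda>j. U (sqrt (?R j) *\<^sub>R fst z) * bump k 1 (qf ((1 / sqrt (?R j)) *\<^sub>R x) (fst z) (snd z)))
        \<longlonglongrightarrow> l * bump k 1 ((norm (fst z))\<^sup>2)"
      using AE_nu[OF a, of x]
    proof eventually_elim
      case (elim z)
      have z: "fst z \<in> half_space" using elim by blast
      have nz: "norm (fst z) > 0" using z by (auto simp: half_space_def)
      have "filterlim (\<lambda>j. sqrt (?R j) *\<^sub>R fst z) (inf at_infinity (principal half_space)) sequentially"
        unfolding filterlim_inf filterlim_principal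
      proof
        have "filterlim (\<lambda>j. norm (sqrt (?R j) *\<^sub>R fst z)) at_top sequentially"
          using filterlim_tendsto_pos_mult_at_top[OF tendsto_const nz sq] by (simp add: mult.commute)
        then show "filterlim (\<lambda>j. sqrt (?R j) *\<^sub>R fst z) at_infinity sequentially"
          by (rule filterlim_norm_at_top_imp_at_infinity)
        show "\<forall>\<^sub>F j in sequentially. sqrt (?R j) *\<^sub>R fst z \<in> half_space"
          using z by (auto simp: half_space_def)
      qed
      then have 1: "(\<lambda>j. U (sqrt (?R j) *\<^sub>R fst z)) \<longlonglongrightarrow> l" by (rule filterlim_compose[OF lim])
      have i0: "(\<lambda>j. 1 / sqrt (?R j)) \<longlonglongrightarrow> 0"
        by (rule tendsto_divide_0[OF tendsto_const filterlim_at_top_imp_at_infinity[OF sq]])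
      have "(\<lambda>j. qf ((1 / sqrt (?R j)) *\<^sub>R x) (fst z) (snd z)) \<longlonglongrightarrow> qf (0 *\<^sub>R x) (fst z) (snd z)"
        unfolding qf_eq by (intro tendsto_intros i0)
      then have "(\<lambda>j. qf ((1 / sqrt (?R j)) *\<^sub>R x) (fst z) (snd z)) \<longlonglongrightarrow> (norm (fst z))\<^sup>2"
        by (simp add: qf_eq)
      then have "(\<lambda>j. bump k 1 (qf ((1 / sqrt (?R j)) *\<^sub>R x) (fst z) (snd z))) \<longlonglongrightarrow> bump k 1 ((norm (fst z))\<^sup>2)"
        unfolding bump_def by (intro tendsto_intros) auto
      with 1 show ?case by (rule tendsto_mult)
    qed
    show "AE z in nu a. norm (U (sqrt (?R j) *\<^sub>R fst z) * bump k 1 (qf ((1 / sqrt (?R j)) *\<^sub>R x) (fst z) (snd z)))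
        \<le> indicator (cball 0 (norm x + 1)) (fst z) * ?B" for j
      using AE_nu[OF a, of x]
    proof eventually_elim
      case (elim z)
      let ?x = "(1 / sqrt (?R j)) *\<^sub>R x"
      have z: "fst z \<in> half_space" "snd z \<in> {0..1}" using elim by auto
      have x: "norm ?x \<le> norm x" 
        using mult_left_mono[of 1 "sqrt (?R j)" "norm x"] by (simp add: divide_le_eq)
      have U: "\<bar>U (sqrt (?R j) *\<^sub>R fst z)\<bar> \<le> BU"
        using z by (intro bU) (auto simp: half_space_def)
      show ?case
      proof (cases "norm (fst z) \<le> norm x + 1")
        case True
        then show ?thesis
          using U BU bump_le[OF k(2) _ qf_nonneg[OF z(2)], of 1 ?x "fst z"] bump_nonneg[OF k(2), of 1 "qf ?x (fst z) (snd z)"]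
          by (auto simp: abs_mult intro!: mult_mono)
      next
        case False
        have "qf ?x (fst z) (snd z) \<ge> 1"
          by (rule qf_large[OF z(2)]) (use False x in simp)
        then show ?thesis using False by (simp add: bump_zero)
      qed
    qed
  qed (unfold borel_measurable_nu, measurable)
  then show ?thesis
    unfolding bump_mass_def by (subst integral_bump_scale[OF a k _ Um bU]) auto
qed

text \<open>
  The constant function solves the equation with zero right-hand side, so its averages do not depend on the
  radius \<open>d\<close> and equal their limit at infinity.
\<close>

lemma integral_bump:
  fixes x :: "(real^'n::finite) \<times> real"
  assumes a: "a > 0" and k: "k = (real CARD('n) + a - 1) / 2" "k > 0" and d: "d > 0"
  shows "(LINT z|nu a. bump k d (qf x (fst z) (snd z))) = bump_mass TYPE('n) a k"
proof -
  let ?I = "\<lambda>d. LINT z|nu a. 1 * bump k d (qf x (fst z) (snd z))"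
  have sol: "weighted_poisson a (\<lambda>_::(real^'n) \<times> real. 1) (\<lambda>_. 0)"
    unfolding weighted_poisson_def by (auto intro!: exI[of _ "\<lambda>_ _. 0"])
  have "(\<lambda>j. ?I (real (Suc j))) \<longlonglongrightarrow> 1 * bump_mass TYPE('n) a k"
    by (rule tendsto_bump_top[OF a k, where BU = 1]) auto
  moreover have "eventually (\<lambda>j. ?I (real (Suc j)) = ?I d) sequentially"
  proof -
    obtain m where m: "real m \<ge> d" using real_arch_simple by blast
    have "?I (real (Suc j)) = ?I d" if "j \<ge> m" for j
    proof -
      have "d \<le> real (Suc j)" using m that by linarith
      from truncated_representation(1)[OF a k sol _ _ d this, where BU = 1 and Bf = 0 and x = x] show ?thesis by simp
    qed
    then show ?thesis unfolding eventually_sequentially by blast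
  qed
  ultimately have "(\<lambda>j. ?I d) \<longlonglongrightarrow> bump_mass TYPE('n) a k"
    using Lim_transform_eventually by fastforce
  then have "?I d = bump_mass TYPE('n) a k" by (simp add: LIMSEQ_const_iff)
  then show ?thesis by simp
qed

text \<open>All these averages have the same mass, so only concentration matters: where the bump is
  nonzero, \<open>y\<close> is within \<open>sqrt d\<close> of \<open>x\<close>, and continuity of
  \<open>U\<close> at \<open>x\<close> finishes.\<close>

lemma tendsto_bump_0:
  fixes U :: "(real^'n::finite) \<times> real \<Rightarrow> real"
  assumes a: "a > 0" and k: "k = (real CARD('n) + a - 1) / 2" "k > 0"
    and cU: "continuous_on UNIV U"
    and bU: "\<And>y. y \<in> half_space \<Longrightarrow> \<bar>U y\<bar> \<le> BU"
    and x: "x \<in> half_space"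
  shows "(\<lambda>j. LINT z|nu a. U (fst z) * bump k (1 / real (Suc j)) (qf x (fst z) (snd z)))
    \<longlonglongrightarrow> U x * bump_mass TYPE('n) a k"
proof -
  let ?C = "bump_mass TYPE('n) a k"
  let ?\<nu> = "(nu a :: (((real^'n) \<times> real) \<times> real) measure)"
  have [measurable]: "U \<in> borel_measurable borel" using cU by (rule borel_measurable_continuous_onI)
  have C: "?C \<ge> 0" unfolding bump_mass_def by (rule integral_nonneg_AE) (simp add: bump_nonneg[OF k(2)])
  have i1: "integrable ?\<nu> (\<lambda>z. 1 * bump k d (qf x (fst z) (snd z)))" if "d > 0" for d
    by (rule integrable_bump[OF a k(2) that, where BU = 1]) auto
  have iU: "integrable ?\<nu> (\<lambda>z. U (fst z) * bump k d (qf x (fst z) (snd z)))" if "d > 0" for d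
    by (rule integrable_bump[OF a k(2) that _ bU]) auto
  show ?thesis
  proof (rule LIMSEQ_I)
    fix r :: real assume r: "r > 0"
    \<comment> \<open>Adding 1 keeps the denominator positive, as the mass is only known to be
      nonnegative here; the product with the mass stays below \<open>r\<close>.\<close>
    define \<eta> where "\<eta> = r / (2 * (?C + 1))"
    have "0 \<le> r * ?C" using r C by simp
    then have \<eta>: "\<eta> > 0" "\<eta> * ?C < r" using r C by (auto simp: \<eta>_def field_simps intro!: add_pos_nonneg)
    have "isCont U x" using cU continuous_on_eq_continuous_at[OF open_UNIV] by blast
    then obtain s where s: "s > 0" "\<And>y. dist y x < s \<Longrightarrow> dist (U y) (U x) < \<eta>"
      using \<eta>(1) unfolding continuous_at_eps_delta by (auto simp: dist_commute)
    have "(\<lambda>j. 1 / real (Suc j)) \<longlonglongrightarrow> 0" by (rule LIMSEQ_Suc[OF lim_1_over_n])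
    then have "eventually (\<lambda>j. 1 / real (Suc j) < s\<^sup>2) sequentially" using s(1) by (intro order_tendstoD(2)) auto
    then obtain J where J: "\<And>j. j \<ge> J \<Longrightarrow> 1 / real (Suc j) < s\<^sup>2" by (auto simp: eventually_sequentially)
    have "norm ((LINT z|?\<nu>. U (fst z) * bump k (1 / real (Suc j)) (qf x (fst z) (snd z))) - U x * ?C) < r" if j: "j \<ge> J" for j
    proof -
      define d where "d = 1 / real (Suc j)"
      have d: "d > 0" "d < s\<^sup>2" using J[OF j] by (auto simp: d_def)
      let ?b = "\<lambda>z. bump k d (qf x (fst z) (snd z))"
      have i: "integrable ?\<nu> (\<lambda>z. U (fst z) * ?b z - U x * ?b z)"
        using iU[OF d(1)] i1[OF d(1)] by simp
      have "(LINT z|?\<nu>. U (fst z) * ?b z) - U x * ?C = (LINT z|?\<nu>. U (fst z) * ?b z - U x * ?b z)"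
        using iU[OF d(1)] i1[OF d(1)] integral_bump[OF a k d(1), of x] by simp
      also have "\<bar>\<dots>\<bar> \<le> (LINT z|?\<nu>. \<bar>U (fst z) * ?b z - U x * ?b z\<bar>)" by (rule integral_abs_bound)
      also have "\<dots> \<le> (LINT z|?\<nu>. \<eta> * ?b z)"
      proof (rule integral_mono_AE)
        show "integrable ?\<nu> (\<lambda>z. \<bar>U (fst z) * ?b z - U x * ?b z\<bar>)" using i by simp
        show "integrable ?\<nu> (\<lambda>z. \<eta> * ?b z)" using i1[OF d(1)] by simp
        show "AE z in ?\<nu>. \<bar>U (fst z) * ?b z - U x * ?b z\<bar> \<le> \<eta> * ?b z"
          using AE_nu[OF a, of x]
        proof eventually_elim
          case (elim z)
          show ?case
          proof (cases "qf x (fst z) (snd z) < d")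
            case True
            \<comment> \<open>The \<tau>-term of \<open>qf\<close> is nonnegative because both
              heights are positive, so a small \<open>qf\<close> forces \<open>y\<close> close to
              \<open>x\<close>.\<close>
            have "(norm (x - fst z))\<^sup>2 \<le> qf x (fst z) (snd z)"
              unfolding qf_eq using elim x by (simp add: half_space_def)
            then have "(norm (x - fst z))\<^sup>2 < s\<^sup>2" using True d by simp
            then have "dist (fst z) x < s" using s(1) by (simp add: dist_norm norm_minus_commute power2_less_imp_less)
            from s(2)[OF this] have "\<bar>U (fst z) - U x\<bar> \<le> \<eta>" by (simp add: dist_real_def)
            moreover have "?b z \<ge> 0" by (rule bump_nonneg[OF k(2)])
            moreover have "\<bar>U (fst z) * ?b z - U x * ?b z\<bar> = \<bar>U (fst z) - U x\<bar> * ?b z"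
              using bump_nonneg[OF k(2)] by (simp add: abs_mult flip: left_diff_distrib)
            ultimately show ?thesis by (simp add: mult_right_mono)
          next
            case False
            then show ?thesis using bump_zero[OF d(1), of "qf x (fst z) (snd z)" k] by simp
          qed
        qed
      qed
      also have "\<dots> = \<eta> * ?C" using integral_bump[OF a k d(1), of x] by simp
      finally show ?thesis using \<eta>(2) unfolding d_def by simp
    qed
    then show "\<exists>no. \<forall>n\<ge>no. norm ((LINT z|?\<nu>. U (fst z) * bump k (1 / real (Suc n)) (qf x (fst z) (snd z))) - U x * ?C) < r"
      by blast
  qed
qed

text \<open>For fixed q > 0 the small truncation is eventually \<open>q powr (- k)\<close> and the
  large one tends to 0; both changes increase the difference, and f \<ge> 0 preserves the order.
  Convergence of the integrals then yields integrability of the singular integrand together with its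
  value.\<close>

lemma newtonian_representation:
  fixes U f :: "(real^'n::finite) \<times> real \<Rightarrow> real"
  assumes a: "a > 0" and k: "k = (real CARD('n) + a - 1) / 2" "k > 0"
    and sol: "weighted_poisson a U f"
    and bU: "\<And>y. y \<in> half_space \<Longrightarrow> \<bar>U y\<bar> \<le> BU"
    and bf: "\<And>y. y \<in> half_space \<Longrightarrow> \<bar>f y\<bar> \<le> Bf"
    and f: "\<And>y. y \<in> half_space \<Longrightarrow> f y \<ge> 0"
    and lim: "(U \<longlongrightarrow> 0) (inf at_infinity (principal half_space))"
    and x: "x \<in> half_space"
  shows "integrable (nu a) (\<lambda>z. f (fst z) * qf x (fst z) (snd z) powr (- k))"
    and "(LINT z|nu a. f (fst z) * qf x (fst z) (snd z) powr (- k)) = U x * bump_mass TYPE('n) a k"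
proof -
  let ?\<nu> = "(nu a :: (((real^'n) \<times> real) \<times> real) measure)"
  let ?q = "\<lambda>z. qf x (fst z) (snd z)"
  let ?T = "\<lambda>j z. f (fst z) * (trunc k (1 / real (Suc j)) (?q z) - trunc k (real (Suc j)) (?q z))"
  have cU: "continuous_on UNIV U" and [measurable]: "f \<in> borel_measurable borel"
    using sol by (auto simp: weighted_poisson_def)
  have [measurable]: "U \<in> borel_measurable borel" using cU by (rule borel_measurable_continuous_onI)
  have le: "0 < 1 / real (Suc j)" "1 / real (Suc j) \<le> real (Suc j)" for j
    by (simp, rule order.trans[of _ 1]) auto
  note tr = truncated_representation[OF a k sol bU bf le, where x = x]
  have T_eq: "(LINT z|?\<nu>. ?T j z) = (LINT z|?\<nu>. U (fst z) * bump k (1 / real (Suc j)) (?q z))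
      - (LINT z|?\<nu>. U (fst z) * bump k (real (Suc j)) (?q z))" for j
    by (rule tr(1))
  have lims: "(\<lambda>j. LINT z|?\<nu>. ?T j z) \<longlonglongrightarrow> U x * bump_mass TYPE('n) a k"
    unfolding T_eq
    using tendsto_diff[OF tendsto_bump_0[OF a k cU bU x] tendsto_bump_top[OF a k _ bU lim, where x = x]] by (simp del: of_nat_Suc)
  have mono: "AE z in ?\<nu>. mono (\<lambda>j. ?T j z)"
    using AE_nu[OF a, of x]
  proof eventually_elim
    case (elim z)
    have q: "?q z \<ge> 0" using elim by (intro qf_nonneg) auto
    show ?case
    proof (rule monoI)
      fix i j :: nat assume "i \<le> j"
      then have "1 / real (Suc j) \<le> 1 / real (Suc i)" "real (Suc i) \<le> real (Suc j)" by (auto simp: field_simps)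
      then have "trunc k (1 / real (Suc i)) (?q z) \<le> trunc k (1 / real (Suc j)) (?q z)"
         "trunc k (real (Suc j)) (?q z) \<le> trunc k (real (Suc i)) (?q z)"
        by (intro trunc_antimono[OF k(2) q]; simp)+
      then show "?T i z \<le> ?T j z" using elim by (intro mult_left_mono diff_mono f) auto
    qed
  qed
  have conv: "AE z in ?\<nu>. (\<lambda>j. ?T j z) \<longlonglongrightarrow> f (fst z) * ?q z powr (- k)"
    using AE_nu[OF a, of x]
  proof eventually_elim
    case (elim z)
    \<comment> \<open>Strict positivity of \<open>q\<close> comes from the diagonal being a null
      set; at q > 0 the small truncation is eventually exact.\<close>
    have "0 < (norm (x - fst z))\<^sup>2" using elim by (simp add: eq_commute[of x])
    also have "\<dots> \<le> ?q z" unfolding qf_eq using elim x by (simp add: half_space_def)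
    finally have q: "?q z > 0" .
    have "(\<lambda>j. ?T j z) \<longlonglongrightarrow> f (fst z) * (?q z powr (- k) - 0)"
      by (intro tendsto_mult tendsto_diff tendsto_const tendsto_trunc_0 tendsto_trunc_top k(2) q)
    then show ?case by simp
  qed
  have m: "(\<lambda>z. f (fst z) * ?q z powr (- k)) \<in> borel_measurable ?\<nu>"
    unfolding borel_measurable_nu by measurable
  show "integrable ?\<nu> (\<lambda>z. f (fst z) * ?q z powr (- k))"
    by (rule integrable_monotone_convergence[OF tr(2) mono conv lims m])
  show "(LINT z|?\<nu>. f (fst z) * ?q z powr (- k)) = U x * bump_mass TYPE('n) a k"
    by (rule integral_monotone_convergence[OF tr(2) mono conv lims m])
qed

subsection \<open>The normalising constant\<close>

text \<open>Monotone exhaustion, used to carry a change of variables from compact intervals to the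
  half line.\<close>

lemma nn_integral_half_line_LIMSEQ:
  fixes f :: "real \<Rightarrow> ennreal"
  assumes [measurable]: "f \<in> borel_measurable borel" and c: "incseq c" "filterlim c at_top sequentially"
  shows "(\<lambda>n. \<integral>\<^sup>+x. f x * indicator {0..c n} x \<partial>lborel) \<longlonglongrightarrow> (\<integral>\<^sup>+x. f x * indicator {0..} x \<partial>lborel)"
proof (rule nn_integral_LIMSEQ)
  show "incseq (\<lambda>n x. f x * indicator {0..c n} x)"
  proof (rule incseq_SucI, rule le_funI)
    show "f x * indicator {0..c n} x \<le> f x * indicator {0..c (Suc n)} x" for n x
      using incseq_SucD[OF c(1), of n] by (cases "x \<in> {0..c n}") auto
  qed
  show "(\<lambda>n. f x * indicator {0..c n} x) \<longlonglongrightarrow> f x * indicator {0..} x" for x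
  proof (rule tendsto_eventually)
    have "eventually (\<lambda>n. c n \<ge> x) sequentially" using c(2) by (simp add: filterlim_at_top)
    then show "eventually (\<lambda>n. f x * indicator {0..c n} x = f x * indicator {0..} x) sequentially"
      by eventually_elim (simp add: indicator_def)
  qed
qed measurable

text \<open>The substitution v = t^2 turns the Gamma integral at (a + 1) / 2 into twice this
  moment.\<close>

lemma nn_integral_gaussian_moment:
  assumes a: "a > -1"
  shows "(\<integral>\<^sup>+t. ennreal (indicator {0<..} t * t powr a * exp (- t\<^sup>2)) \<partial>lborel) = ennreal (Gamma ((a + 1) / 2) / 2)"
proof -
  let ?f = "\<lambda>v::real. ennreal (v powr ((a + 1) / 2 - 1) / exp v)"
  let ?g = "\<lambda>t::real. ?f (t\<^sup>2) * ennreal (2 * t)"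
  define c where "c n = real (Suc n)" for n
  have c: "incseq c" "filterlim c at_top sequentially"
    unfolding c_def incseq_def by (simp, rule filterlim_compose[OF filterlim_real_sequentially filterlim_Suc])
  have c2: "incseq (\<lambda>n. (c n)\<^sup>2)"
    unfolding c_def incseq_def by (auto intro: power_mono)
  have c2': "filterlim (\<lambda>n. (c n)\<^sup>2) at_top sequentially"
    using c(2) by (rule filterlim_pow_at_top[rotated]) simp
  have sub: "(\<integral>\<^sup>+x. ?f x * indicator {0..(c n)\<^sup>2} x \<partial>lborel) = (\<integral>\<^sup>+x. ?g x * indicator {0..c n} x \<partial>lborel)" for n
  proof -
    have "(\<integral>\<^sup>+x. ?f x * indicator {0\<^sup>2..(c n)\<^sup>2} x \<partial>lborel) = (\<integral>\<^sup>+x. ?f (x\<^sup>2) * (2 * x) * indicator {0..c n} x \<partial>lborel)"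
      by (rule nn_integral_substitution_aux[where g = "\<lambda>t. t\<^sup>2" and g' = "\<lambda>t. 2 * t"])
        (auto intro!: derivative_eq_intros continuous_intros simp: c_def)
    then show ?thesis by simp
  qed
  have "(\<lambda>n. \<integral>\<^sup>+x. ?f x * indicator {0..(c n)\<^sup>2} x \<partial>lborel) \<longlonglongrightarrow> (\<integral>\<^sup>+x. ?f x * indicator {0..} x \<partial>lborel)"
    by (rule nn_integral_half_line_LIMSEQ[OF _ c2 c2']) measurable
  moreover have "(\<lambda>n. \<integral>\<^sup>+x. ?g x * indicator {0..c n} x \<partial>lborel) \<longlonglongrightarrow> (\<integral>\<^sup>+x. ?g x * indicator {0..} x \<partial>lborel)"
    by (rule nn_integral_half_line_LIMSEQ[OF _ c]) measurable
  ultimately have eq: "(\<integral>\<^sup>+x. ?f x * indicator {0..} x \<partial>lborel) = (\<integral>\<^sup>+x. ?g x * indicator {0..} x \<partial>lborel)"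
    unfolding sub by (rule LIMSEQ_unique)
  have "ennreal (Gamma ((a + 1) / 2)) = (\<integral>\<^sup>+x. ?f x * indicator {0..} x \<partial>lborel)"
    using a by (subst Gamma_conv_nn_integral_real) (auto intro!: nn_integral_cong simp: indicator_def)
  also have "\<dots> = (\<integral>\<^sup>+t. 2 * ennreal (indicator {0<..} t * t powr a * exp (- t\<^sup>2)) \<partial>lborel)"
    unfolding eq
  proof (intro nn_integral_cong)
    fix t :: real
    show "?g t * indicator {0..} t = 2 * ennreal (indicator {0<..} t * t powr a * exp (- t\<^sup>2))"
    proof (cases "t > 0")
      case True
      have "t\<^sup>2 = t powr 2" using True by simp
      moreover have "2 * ((a + 1) / 2 - 1) = a - 1" by simp
      ultimately have "(t\<^sup>2) powr ((a + 1) / 2 - 1) = t powr (a - 1)" by (simp only: powr_powr)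
      then have "(t\<^sup>2) powr ((a + 1) / 2 - 1) / exp (t\<^sup>2) * (2 * t) = 2 * (t powr a * exp (- t\<^sup>2))"
        using True by (simp add: powr_diff exp_minus field_simps)
      then have "?g t = 2 * ennreal (t powr a * exp (- t\<^sup>2))"
        using True by (simp flip: ennreal_mult' ennreal_numeral)
      then show ?thesis using True by simp
    next
      case False
      then show ?thesis by (cases "t = 0") auto
    qed
  qed
  also have "\<dots> = 2 * (\<integral>\<^sup>+t. ennreal (indicator {0<..} t * t powr a * exp (- t\<^sup>2)) \<partial>lborel)"
    by (rule nn_integral_cmult) measurable
  finally have "ennreal (1 / 2) * ennreal (Gamma ((a + 1) / 2)) =
      ennreal (1 / 2) * 2 * (\<integral>\<^sup>+t. ennreal (indicator {0<..} t * t powr a * exp (- t\<^sup>2)) \<partial>lborel)"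
    by (simp add: mult.assoc)
  moreover have "ennreal (1 / 2) * 2 = 1" by (subst ennreal_numeral[symmetric], subst ennreal_mult[symmetric]) auto
  moreover have "ennreal (1 / 2) * ennreal (Gamma ((a + 1) / 2)) = ennreal (1 / 2 * Gamma ((a + 1) / 2))"
    by (rule ennreal_mult'[symmetric]) simp
  ultimately show ?thesis by (simp only: mult_1_left) simp
qed

lemma nn_integral_gaussian: "(\<integral>\<^sup>+t. ennreal (exp (- t\<^sup>2)) \<partial>lborel) = ennreal (sqrt pi)"
proof -
  let ?h = "\<lambda>t::real. ennreal (indicator {0<..} t * t powr 0 * exp (- t\<^sup>2))"
  have h: "(\<integral>\<^sup>+t. ?h t \<partial>lborel) = ennreal (sqrt pi / 2)"
    using nn_integral_gaussian_moment[of 0] by (simp add: Gamma_one_half_real)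
  have "(\<integral>\<^sup>+t. ennreal (exp (- t\<^sup>2)) \<partial>lborel) = (\<integral>\<^sup>+t. ?h t + ?h (- t) \<partial>lborel)"
  proof (rule nn_integral_cong_AE)
    show "AE t in lborel. ennreal (exp (- t\<^sup>2)) = ?h t + ?h (- t)"
      using AE_lborel_singleton[of 0] by eventually_elim (auto simp: indicator_def)
  qed
  also have "\<dots> = (\<integral>\<^sup>+t. ?h t \<partial>lborel) + (\<integral>\<^sup>+t. ?h (- t) \<partial>lborel)" by (rule nn_integral_add) measurable
  also have "(\<integral>\<^sup>+t. ?h (- t) \<partial>lborel) = (\<integral>\<^sup>+t. ?h t \<partial>lborel)"
    using nn_integral_real_affine[of ?h "-1" 0] by simp
  finally show ?thesis unfolding h by (simp flip: ennreal_plus)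
qed

text \<open>The weight depends on the last coordinate alone, so the weighted Gaussian is a product
  over coordinates: one half-line moment and n full Gaussians.\<close>

lemma nn_integral_mu_gaussian:
  assumes a: "a > 0"
  shows "(\<integral>\<^sup>+y. ennreal (exp (- (norm y)\<^sup>2)) \<partial>(mu a :: ((real^'n::finite) \<times> real) measure))
    = ennreal (pi powr (real CARD('n) / 2) * Gamma ((a + 1) / 2) / 2)"
proof -
  define S where "S = (\<lambda>e::real^'n. (e, 0::real)) ` Basis"
  have S: "Basis = insert (0, 1) S" "(0, 1) \<notin> S" "finite S" unfolding S_def by (auto simp: Basis_prod_real)
  have cS: "card S = CARD('n)" unfolding S_def by (subst card_image) (auto intro: inj_onI)
  define F :: "(real^'n) \<times> real \<Rightarrow> real \<Rightarrow> ennreal" where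
    "F b t = (if b = (0, 1) then ennreal (indicator {0<..} t * t powr a * exp (- t\<^sup>2)) else ennreal (exp (- t\<^sup>2)))" for b t
  have Fm: "F b \<in> borel_measurable borel" for b unfolding F_def by (cases "b = (0, 1)") simp_all
  have pt: "ennreal (indicator half_space y * snd y powr a) * ennreal (exp (- (norm y)\<^sup>2)) = (\<Prod>b\<in>Basis. F b (y \<bullet> b))" for y :: "(real^'n) \<times> real"
  proof -
    have "(norm y)\<^sup>2 = (\<Sum>b\<in>Basis. (y \<bullet> b)\<^sup>2)"
      unfolding power2_norm_eq_inner by (simp add: euclidean_inner[of y y] power2_eq_square)
    also have "\<dots> = (snd y)\<^sup>2 + (\<Sum>b\<in>S. (y \<bullet> b)\<^sup>2)"
      unfolding S(1) using S(2,3) by (cases y) simp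
    finally have e: "exp (- (norm y)\<^sup>2) = exp (- (snd y)\<^sup>2) * (\<Prod>b\<in>S. exp (- (y \<bullet> b)\<^sup>2))"
      by (simp add: exp_add exp_diff exp_minus exp_sum[OF S(3)] prod_inversef[symmetric] divide_inverse flip: sum_negf)
    have "(\<Prod>b\<in>S. F b (y \<bullet> b)) = ennreal (\<Prod>b\<in>S. exp (- (y \<bullet> b)\<^sup>2))"
      using S(2) by (subst prod_ennreal[symmetric]) (auto simp: F_def intro!: prod.cong)
    moreover have "F (0, 1) (y \<bullet> (0, 1)) = ennreal (indicator half_space y * snd y powr a * exp (- (snd y)\<^sup>2))"
      by (cases y) (simp add: F_def half_space_def indicator_def)
    ultimately show ?thesis
      unfolding S(1) e using S(2,3) by (simp add: ennreal_mult' prod_nonneg mult_ac)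
  qed
  have "(\<integral>\<^sup>+y. ennreal (exp (- (norm y)\<^sup>2)) \<partial>(mu a :: ((real^'n) \<times> real) measure))
      = (\<integral>\<^sup>+y. (\<Prod>b\<in>Basis. F b (y \<bullet> b)) \<partial>(lborel :: ((real^'n) \<times> real) measure))"
    unfolding mu_def by (subst nn_integral_density) (simp_all add: pt)
  also have "\<dots> = (\<Prod>b\<in>Basis. (\<integral>\<^sup>+t. F b t \<partial>lborel))"
    by (rule nn_integral_lborel_prod[OF Fm]) simp
  also have "\<dots> = ennreal (Gamma ((a + 1) / 2) / 2) * (\<Prod>b\<in>S. (\<integral>\<^sup>+t. F b t \<partial>lborel))"
    unfolding S(1) using S(2,3) a by (simp add: F_def nn_integral_gaussian_moment)
  also have "(\<Prod>b\<in>S. (\<integral>\<^sup>+t. F b t \<partial>lborel)) = (\<Prod>b\<in>S. ennreal (sqrt pi))"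
  proof (intro prod.cong refl)
    fix b assume "b \<in> S"
    then have "b \<noteq> (0, 1)" using S(2) by blast
    then show "(\<integral>\<^sup>+t. F b t \<partial>lborel) = ennreal (sqrt pi)" by (simp add: F_def nn_integral_gaussian)
  qed
  also have "\<dots> = ennreal (pi powr (real CARD('n) / 2))"
    by (simp add: cS ennreal_power powr_half_sqrt[symmetric] powr_realpow[symmetric] powr_powr)
  finally show ?thesis using a Gamma_real_pos[of "(a + 1) / 2"] by (simp flip: ennreal_mult' add: mult.commute)
qed

text \<open>
  The Laplace transform in \<open>r\<close> of \<open>max 0 (r - |y|\<^sup>2)\<close> is a Gaussian, whose weighted mass factorises over the
  coordinates.
\<close>

lemma nn_integral_laplace_hat:
  assumes "c \<ge> 0"
  shows "(\<integral>\<^sup>+r. ennreal (exp (- r) * max 0 (r - c)) \<partial>lborel) = ennreal (exp (- c))"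
proof -
  have "(\<integral>\<^sup>+r. ennreal (exp (- r) * max 0 (r - c)) \<partial>lborel) = (\<integral>\<^sup>+v. ennreal (exp (- (c + v)) * max 0 v) \<partial>lborel)"
    using nn_integral_real_affine[of "\<lambda>r. ennreal (exp (- r) * max 0 (r - c))" 1 c] by simp
  also have "\<dots> = (\<integral>\<^sup>+v. ennreal (exp (- c)) * ennreal (indicator {0..} v * v powr (2 - 1) / exp v) \<partial>lborel)"
    by (intro nn_integral_cong) (auto simp: indicator_def max_def exp_add exp_minus exp_diff field_simps simp flip: ennreal_mult')
  also have "\<dots> = ennreal (exp (- c)) * ennreal (Gamma 2)"
    by (subst nn_integral_cmult) (auto simp: Gamma_conv_nn_integral_real[of 2])
  also have "Gamma (2::real) = 1" using Gamma_fact[of 1, where 'a = real] by simp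
  finally show ?thesis by simp
qed

text \<open>With G for this integral, scaling gives r^(k+2) G for the integral of
  \<open>max 0 (r - (norm y)^2)\<close>. Integrated against e^(-r) this is G times
  \<open>Gamma (k + 3)\<close>, while Fubini in the other order gives the Gaussian mass.\<close>

lemma integral_mu_hat:
  assumes a: "a > 0" and k: "k = (real CARD('n::finite) + a - 1) / 2" "k > 0"
  shows "(LINT y|(mu a :: ((real^'n) \<times> real) measure). max 0 (1 - (norm y)\<^sup>2)) * Gamma (k + 3)
    = pi powr (real CARD('n) / 2) * Gamma ((a + 1) / 2) / 2"
proof -
  let ?\<mu> = "mu a :: ((real^'n) \<times> real) measure"
  define G where "G = (LINT y|?\<mu>. max 0 (1 - (norm y)\<^sup>2))"
  have G0: "G \<ge> 0" unfolding G_def by (rule integral_nonneg_AE) simp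
  have int: "integrable ?\<mu> (\<lambda>y. max 0 (r - (norm y)\<^sup>2))" if "r > 0" for r
  proof (rule integrable_mu_bounded[OF a, where B = r and r = "sqrt r"])
    fix y :: "(real^'n) \<times> real" assume y: "y \<in> half_space"
    have "\<bar>max 0 (r - (norm y)\<^sup>2)\<bar> \<le> r" using that by (simp add: max_def)
    also have "\<dots> \<le> r * (1 + 1 / snd y)" using that y by (intro le_one_plus_inverse_height) auto
    finally show "\<bar>max 0 (r - (norm y)\<^sup>2)\<bar> \<le> r * (1 + 1 / snd y)" .
    assume "norm y > sqrt r"
    then have "(sqrt r)\<^sup>2 < (norm y)\<^sup>2" using that by (intro power_strict_mono) auto
    then have "r < (norm y)\<^sup>2" using that by simp
    then show "max 0 (r - (norm y)\<^sup>2) = 0" by simp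
  qed simp
  have sc: "(LINT y|?\<mu>. max 0 (r - (norm y)\<^sup>2)) = r powr (k + 2) * G" if r: "r > 0" for r
  proof -
    have e: "real CARD('n) + 1 + a = 2 * (k + 1)" using k(1) by simp
    have "(LINT y|?\<mu>. max 0 (r - (norm y)\<^sup>2)) = sqrt r powr (2 * (k + 1)) * (LINT y|?\<mu>. max 0 (r - (norm (sqrt r *\<^sub>R y))\<^sup>2))"
      unfolding e[symmetric] by (rule integral_mu_scale) (use r in simp_all)
    also have "(\<lambda>y::(real^'n) \<times> real. max 0 (r - (norm (sqrt r *\<^sub>R y))\<^sup>2)) = (\<lambda>y. r * max 0 (1 - (norm y)\<^sup>2))"
      using r by (auto simp: fun_eq_iff power_mult_distrib max_def algebra_simps)
    also have "sqrt r powr (2 * (k + 1)) = r powr (k + 1)"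
      using r by (simp add: powr_half_sqrt[symmetric] powr_powr add_divide_distrib)
    finally show ?thesis using r by (simp add: G_def powr_add power2_eq_square)
  qed
  interpret mu: sigma_finite_measure ?\<mu> by (rule sigma_finite_mu)
  interpret pair_sigma_finite ?\<mu> "lborel :: real measure" ..
  have s: "sets (?\<mu> \<Otimes>\<^sub>M (lborel :: real measure)) = sets borel"
    by (simp add: borel_prod[symmetric] cong: sets_pair_measure_cong)
  let ?h = "\<lambda>z::((real^'n) \<times> real) \<times> real. ennreal (exp (- snd z) * max 0 (snd z - (norm (fst z))\<^sup>2))"
  have hm: "?h \<in> borel_measurable (?\<mu> \<Otimes>\<^sub>M (lborel :: real measure))"
    unfolding measurable_cong_sets[OF s refl] by measurable
  have "(\<integral>\<^sup>+r. (\<integral>\<^sup>+y. ?h (y, r) \<partial>?\<mu>) \<partial>lborel) = (\<integral>\<^sup>+y. (\<integral>\<^sup>+r. ?h (y, r) \<partial>lborel) \<partial>?\<mu>)"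
    by (rule Fubini[OF hm])
  also have "\<dots> = (\<integral>\<^sup>+y. ennreal (exp (- (norm y)\<^sup>2)) \<partial>?\<mu>)"
    by (simp add: nn_integral_laplace_hat)
  also have "\<dots> = ennreal (pi powr (real CARD('n) / 2) * Gamma ((a + 1) / 2) / 2)"
    by (rule nn_integral_mu_gaussian[OF a])
  finally have 1: "(\<integral>\<^sup>+r. (\<integral>\<^sup>+y. ?h (y, r) \<partial>?\<mu>) \<partial>lborel) = ennreal (pi powr (real CARD('n) / 2) * Gamma ((a + 1) / 2) / 2)" .
  have inner: "(\<integral>\<^sup>+y. ?h (y, r) \<partial>?\<mu>) = ennreal G * ennreal (indicator {0..} r * r powr (k + 3 - 1) / exp r)" for r
  proof (cases "r > 0")
    case True
    have "(\<integral>\<^sup>+y. ?h (y, r) \<partial>?\<mu>) = ennreal (LINT y|?\<mu>. exp (- r) * max 0 (r - (norm y)\<^sup>2))"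
      using int[OF True] by (subst nn_integral_eq_integral[symmetric]) auto
    also have "(LINT y|?\<mu>. exp (- r) * max 0 (r - (norm y)\<^sup>2)) = G * (indicator {0..} r * r powr (k + 3 - 1) / exp r)"
      using True by (simp add: sc exp_minus field_simps)
    finally show ?thesis using G0 by (simp only: ennreal_mult')
  next
    case False
    then have "max 0 (r - (norm y)\<^sup>2) = 0" for y :: "(real^'n) \<times> real" by (simp add: max_def) (smt (verit) zero_le_power2)
    then show ?thesis using False by (cases "r = 0") simp_all
  qed
  have "(\<integral>\<^sup>+r. (\<integral>\<^sup>+y. ?h (y, r) \<partial>?\<mu>) \<partial>lborel) = ennreal G * ennreal (Gamma (k + 3))"
    unfolding inner using k(2) by (subst nn_integral_cmult) (auto simp: Gamma_conv_nn_integral_real[of "k + 3"])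
  also have "\<dots> = ennreal (G * Gamma (k + 3))" using G0 by (simp add: ennreal_mult')
  finally have "ennreal (G * Gamma (k + 3)) = ennreal (pi powr (real CARD('n) / 2) * Gamma ((a + 1) / 2) / 2)"
    using 1 by simp
  moreover have "G * Gamma (k + 3) \<ge> 0" using G0 k(2) Gamma_real_pos[of "k + 3"] by simp
  moreover have "pi powr (real CARD('n) / 2) * Gamma ((a + 1) / 2) / 2 \<ge> 0" using a Gamma_real_pos[of "(a + 1) / 2"] by simp
  ultimately show ?thesis unfolding G_def by (simp only: ennreal_inj)
qed

section \<open>Matching the mass of the averages with D\<close>

lemma Gamma_duplication_real:
  fixes x :: real assumes "x > 0"
  shows "Gamma x * Gamma (x + 1 / 2) = 2 powr (1 - 2 * x) * sqrt pi * Gamma (2 * x)"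
proof -
  have "complex_of_real x \<notin> \<int>\<^sub>\<le>\<^sub>0" "complex_of_real x + 1 / 2 \<notin> \<int>\<^sub>\<le>\<^sub>0"
    using assms by (auto elim!: nonpos_Ints_cases simp: complex_eq_iff)
  from Gamma_legendre_duplication[OF this]
  have "Gamma (complex_of_real x) * Gamma (complex_of_real (x + 1 / 2)) =
      exp (complex_of_real ((1 - 2 * x) * ln 2)) * complex_of_real (sqrt pi) * Gamma (complex_of_real (2 * x))" by simp
  then have "complex_of_real (Gamma x * Gamma (x + 1 / 2)) = complex_of_real (exp ((1 - 2 * x) * ln 2) * sqrt pi * Gamma (2 * x))"
    by (simp only: Gamma_complex_of_real exp_of_real flip: of_real_mult)
  then have "Gamma x * Gamma (x + 1 / 2) = exp ((1 - 2 * x) * ln 2) * sqrt pi * Gamma (2 * x)"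
    by (simp only: of_real_eq_iff)
  then show ?thesis by (simp add: powr_def)
qed

text \<open>With the pole at the origin the integrand is free of \<tau>, so the mass factorises into
  the Beta mass, the constant of the bump and the integral of the hat function. What remains is a
  comparison of Gamma factors.\<close>

lemma green_const_bump_mass:
  assumes a: "a > 0" and k: "k = (real CARD('n::finite) + a - 1) / 2" "k > 0"
  shows "green_const TYPE('n) (a + 1) * bump_mass TYPE('n) a k = 1"
proof -
  let ?\<mu> = "mu a :: ((real^'n) \<times> real) measure"
  define G where "G = (LINT y|?\<mu>. max 0 (1 - (norm y)\<^sup>2))"
  interpret mu: sigma_finite_measure ?\<mu> by (rule sigma_finite_mu)
  interpret om: finite_measure "om a" by (rule finite_om[OF a])
  interpret pair_sigma_finite ?\<mu> "om a" ..
  have "integrable (nu a) (\<lambda>z::((real^'n) \<times> real) \<times> real. 1 * bump k 1 (qf 0 (fst z) (snd z)))"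
    by (rule integrable_bump[OF a k(2), where BU = 1]) auto
  then have i: "integrable (nu a) (\<lambda>z::((real^'n) \<times> real) \<times> real. bump k 1 ((norm (fst z))\<^sup>2))"
    by (simp add: qf_eq)
  have "bump_mass TYPE('n) a k = (LINT y|?\<mu>. LINT \<tau>|om a. bump k 1 ((norm (fst (y, \<tau>)))\<^sup>2))"
    unfolding bump_mass_def by (rule integral_fst'[OF i, symmetric])
  also have "\<dots> = measure (om a) UNIV * (4 * k * (k + 1) * (k + 2)) * G"
    by (simp add: bump_def G_def mult.assoc)
  finally have C: "bump_mass TYPE('n) a k = Beta (a / 2) (a / 2) * (4 * k * (k + 1) * (k + 2)) * G"
    by (simp add: mass_om[OF a])
  \<comment> \<open>The factor k (k + 1) (k + 2) is exactly the one in the bump, so the Taylor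
    coefficients of the truncation drop out of the mass.\<close>
  have g3: "Gamma (k + 3) = (k + 2) * (k + 1) * k * Gamma k"
  proof -
    have G1: "Gamma (x + 1) = x * Gamma x" if "x > 0" for x :: real
      using that by (intro Gamma_plus1) (auto elim!: nonpos_Ints_cases)
    show ?thesis using G1[of k] G1[of "k + 1"] G1[of "k + 2"] k(2) by (simp add: add.commute)
  qed
  have pos: "Gamma k > 0" "Gamma (a / 2) > 0" "Gamma a > 0" using a k(2) by auto
  have H: "G * ((k + 2) * (k + 1) * k * Gamma k) = pi powr (real CARD('n) / 2) * Gamma ((a + 1) / 2) / 2"
    using integral_mu_hat[OF a k] unfolding G_def g3 .
  \<comment> \<open>Duplication cancels the \<open>Gamma a\<close> in the denominator of Beta and
    leaves a single \<open>Gamma (a / 2)\<close>, the one in D.\<close>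
  have D: "Gamma (a / 2) * Gamma ((a + 1) / 2) = 2 powr (1 - a) * sqrt pi * Gamma a"
    using Gamma_duplication_real[of "a / 2"] a by (simp add: add_divide_distrib)
  have "bump_mass TYPE('n) a k * (Gamma a * Gamma k) = Gamma (a / 2) * Gamma (a / 2) * 4 * (G * ((k + 2) * (k + 1) * k * Gamma k))"
    unfolding C Beta_def using pos by (simp add: field_simps)
  also have "\<dots> = 2 * pi powr (real CARD('n) / 2) * Gamma (a / 2) * (Gamma (a / 2) * Gamma ((a + 1) / 2))"
    unfolding H by simp
  also have "\<dots> = 2 * pi powr (real CARD('n) / 2) * Gamma (a / 2) * (2 powr (1 - a) * sqrt pi) * Gamma a"
    unfolding D by simp
  finally have E: "bump_mass TYPE('n) a k * Gamma k = 2 * pi powr (real CARD('n) / 2) * Gamma (a / 2) * (2 powr (1 - a) * sqrt pi)"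
    using pos by simp
  have "green_const TYPE('n) (a + 1) = 2 powr (a - 2) * pi powr (- (real CARD('n) + 1) / 2) * (Gamma k / Gamma (a / 2))"
  proof -
    have "real CARD('n) + (a + 1) - 2 = 2 * k" "a + 1 - 3 = a - 2" using k(1) by simp_all
    then show ?thesis by (simp add: green_const_def)
  qed
  then have "green_const TYPE('n) (a + 1) * bump_mass TYPE('n) a k
     = 2 powr (a - 2) * pi powr (- (real CARD('n) + 1) / 2) / Gamma (a / 2) * (bump_mass TYPE('n) a k * Gamma k)"
    by simp
  \<comment> \<open>The exponents of 2 and of pi each add up to zero.\<close>
  also have "\<dots> = (2 powr (a - 2) * 2 powr 1 * 2 powr (1 - a)) * (pi powr (- (real CARD('n) + 1) / 2) * pi powr (real CARD('n) / 2) * pi powr (1 / 2))"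
    unfolding E using pos by (simp add: powr_half_sqrt)
  also have "\<dots> = 2 powr 0 * pi powr 0"
    unfolding powr_add[symmetric] by (intro arg_cong2[of _ _ _ _ "(*)"] arg_cong[of _ _ "(powr) _"]) (simp_all add: field_simps)
  finally show ?thesis by simp
qed

subsection \<open>The integral equation\<close>

lemma closure_half_space: "closure half_space = {x::(real^'n::finite) \<times> real. snd x \<ge> 0}"
proof -
  have "(0, 1) \<bullet> x = snd x" for x :: "(real^'n) \<times> real" by (cases x) simp
  then show ?thesis
    using closure_halfspace_gt[of "(0, 1) :: (real^'n) \<times> real" 0] by (simp add: half_space_def zero_prod_def)
qed

lemma open_half_space: "open (half_space :: ((real^'n::finite) \<times> real) set)"
  unfolding half_space_def by (intro open_Collect_less continuous_intros)

definition extend :: "((real^'n::finite) \<times> real \<Rightarrow> real) \<Rightarrow> (real^'n) \<times> real \<Rightarrow> real" where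
  "extend v y = v (fst y, max 0 (snd y))"

lemma extend_eq: "y \<in> half_space \<Longrightarrow> extend v y = v y"
  by (cases y) (simp add: extend_def half_space_def max_def)

lemma continuous_on_extend:
  assumes "continuous_on (closure half_space) v"
  shows "continuous_on UNIV (extend v)"
  unfolding extend_def
  by (rule continuous_on_compose2[OF assms]) (auto intro!: continuous_intros simp: closure_half_space)

lemma directional_derivative_cong:
  fixes y i :: "(real^'n::finite) \<times> real"
  assumes "((\<lambda>t. v (y + t *\<^sub>R i)) has_real_derivative D) (at 0)" "y \<in> half_space"
    and "\<And>z. z \<in> half_space \<Longrightarrow> w z = v z"
  shows "((\<lambda>t. w (y + t *\<^sub>R i)) has_real_derivative D) (at 0)"
proof (rule has_field_derivative_transform_within_open[OF assms(1)])
  have "continuous_on UNIV (\<lambda>t::real. y + t *\<^sub>R i)" by (intro continuous_intros)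
  from open_vimage[OF open_half_space this] show "open {t. y + t *\<^sub>R i \<in> half_space}" by (simp add: vimage_def)
qed (use assms in auto)

lemma decays_like_tendsto_0:
  fixes u :: "(real^'n::finite) \<times> real \<Rightarrow> real"
  assumes "decays_like u closed_half_space p" "p > 0"
  shows "(u \<longlongrightarrow> 0) (inf at_infinity (principal half_space))"
proof -
  let ?F = "inf at_infinity (principal (half_space :: ((real^'n) \<times> real) set))"
  obtain C where C: "((\<lambda>x. norm x powr p * u x) \<longlongrightarrow> C) (inf at_infinity (principal closed_half_space))"
    using assms(1) by (auto simp: decays_like_def)
  have "?F \<le> inf at_infinity (principal closed_half_space)"
    by (intro inf_mono) (auto simp: half_space_def closed_half_space_def)
  from tendsto_mono[OF this C] have C': "((\<lambda>x. norm x powr p * u x) \<longlongrightarrow> C) ?F" .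
  have "filterlim (norm :: (real^'n) \<times> real \<Rightarrow> real) at_top ?F"
    by (rule filterlim_mono[OF filterlim_norm_at_top order_refl inf_le1])
  then have "((\<lambda>x::(real^'n) \<times> real. norm x powr (- p)) \<longlongrightarrow> 0) ?F"
    using assms(2) by (intro tendsto_neg_powr) auto
  from tendsto_mult[OF this C'] have "((\<lambda>x. norm x powr (- p) * (norm x powr p * u x)) \<longlongrightarrow> 0) ?F" by simp
  then show ?thesis
  proof (rule Lim_transform_eventually)
    show "eventually (\<lambda>x. norm x powr (- p) * (norm x powr p * u x) = u x) ?F"
      unfolding eventually_inf_principal
    proof (rule always_eventually, intro allI impI)
      fix x :: "(real^'n) \<times> real" assume "x \<in> half_space"
      then have "norm x > 0" by (auto simp: half_space_def)
      then show "norm x powr (- p) * (norm x powr p * u x) = u x"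
        by (simp add: powr_minus)
    qed
  qed
qed

text \<open>Far out the limit gives the bound 1; the remaining points lie in a compact ball, on
  which the continuous \<open>U\<close> is bounded.\<close>

lemma bounded_if_tendsto_0:
  fixes U :: "(real^'n::finite) \<times> real \<Rightarrow> real"
  assumes "continuous_on UNIV U" "(U \<longlongrightarrow> 0) (inf at_infinity (principal half_space))"
  obtains B where "\<And>y. y \<in> half_space \<Longrightarrow> \<bar>U y\<bar> \<le> B"
proof -
  have "eventually (\<lambda>y. dist (U y) 0 < 1) (inf at_infinity (principal half_space))"
    using assms(2) by (rule tendstoD) simp
  then obtain R where R: "\<And>y. norm y \<ge> R \<Longrightarrow> y \<in> half_space \<Longrightarrow> \<bar>U y\<bar> < 1"
    unfolding eventually_inf_principal eventually_at_infinity by auto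
  have "compact (U ` cball 0 R)"
    by (intro compact_continuous_image continuous_on_subset[OF assms(1)]) auto
  then obtain B where B: "\<And>y. y \<in> cball 0 R \<Longrightarrow> norm (U y) \<le> B"
    by (force dest!: compact_imp_bounded simp: bounded_iff)
  have "\<bar>U y\<bar> \<le> max 1 B" if "y \<in> half_space" for y
    using R[OF _ that] B[of y] by (cases "norm y \<le> R") force+
  then show ?thesis using that by blast
qed

text \<open>\<open>partial i u\<close> is known to be \<open>g i\<close> only inside the half space.
  Since that set is open, agreement there is enough to differentiate once more and identify the
  second partials with \<open>gg i\<close>.\<close>

lemma weighted_poisson_extend:
  fixes u :: "(real^'n::finite) \<times> real \<Rightarrow> real"
  assumes "C_closure 2 half_space u"
    and eq: "\<forall>x\<in>half_space. laplacian u x + a / snd x * partial (0, 1) u x + h (u x) = 0"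
    and [measurable]: "h \<in> borel_measurable borel"
  shows "weighted_poisson a (extend u) (\<lambda>y. h (extend u y))"
proof -
  have cu: "continuous_on (closure half_space) u"
    and "\<forall>i\<in>Basis. \<exists>g. C_closure (Suc 0) half_space g \<and>
        (\<forall>x\<in>half_space. ((\<lambda>t. u (x + t *\<^sub>R i)) has_real_derivative g x) (at 0))"
    using assms(1) by (simp_all add: numeral_2_eq_2)
  then obtain g where g: "\<And>i. i \<in> Basis \<Longrightarrow> C_closure (Suc 0) half_space (g i)"
    "\<And>i x. i \<in> Basis \<Longrightarrow> x \<in> half_space \<Longrightarrow> ((\<lambda>t. u (x + t *\<^sub>R i)) has_real_derivative g i x) (at 0)"
    by metis
  have "\<forall>i\<in>Basis. \<exists>h. continuous_on (closure half_space) h \<and>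
      (\<forall>x\<in>half_space. ((\<lambda>t. g i (x + t *\<^sub>R i)) has_real_derivative h x) (at 0))"
    using g(1) by simp
  then obtain gg where gg: "\<And>i. i \<in> Basis \<Longrightarrow> continuous_on (closure half_space) (gg i)"
    "\<And>i x. i \<in> Basis \<Longrightarrow> x \<in> half_space \<Longrightarrow> ((\<lambda>t. g i (x + t *\<^sub>R i)) has_real_derivative gg i x) (at 0)"
    by metis
  have cg: "continuous_on (closure half_space) (g i)" if "i \<in> Basis" for i
    using g(1)[OF that] by simp
  have p1: "partial i u x = g i x" if "i \<in> Basis" "x \<in> half_space" for i x
    unfolding partial_def by (rule DERIV_imp_deriv[OF g(2)[OF that]])
  have p2: "partial i (partial i u) x = gg i x" if "i \<in> Basis" "x \<in> half_space" for i x
    unfolding partial_def[of i "partial i u"]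
    by (rule DERIV_imp_deriv[OF directional_derivative_cong[OF gg(2)[OF that] that(2)]]) (rule p1[OF that(1)])
  have b01: "(0, 1) \<in> (Basis :: ((real^'n) \<times> real) set)" by (simp add: Basis_prod_real)
  have cU: "continuous_on UNIV (extend u)" by (rule continuous_on_extend[OF cu])
  have [measurable]: "extend u \<in> borel_measurable borel" by (rule borel_measurable_continuous_onI[OF cU])
  show ?thesis
    unfolding weighted_poisson_def
  proof (intro conjI exI ballI)
    show "continuous_on UNIV (extend u)" by fact
    show "(\<lambda>y. h (extend u y)) \<in> borel_measurable borel" by measurable
    show "continuous_on UNIV (extend (g i))" "continuous_on UNIV (extend (gg i))" if "i \<in> Basis" for i
      using cg[OF that] gg(1)[OF that] by (auto intro: continuous_on_extend)
    fix y :: "(real^'n) \<times> real" assume y: "y \<in> half_space"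
    show "((\<lambda>t. extend u (y + t *\<^sub>R i)) has_real_derivative extend (g i) y) (at 0)" if "i \<in> Basis" for i
      unfolding extend_eq[OF y]
      by (rule directional_derivative_cong[where v = u, OF g(2)[OF that y] y]) (rule extend_eq)
    show "((\<lambda>t. extend (g i) (y + t *\<^sub>R i)) has_real_derivative extend (gg i) y) (at 0)" if "i \<in> Basis" for i
      unfolding extend_eq[OF y]
      by (rule directional_derivative_cong[where v = "g i", OF gg(2)[OF that y] y]) (rule extend_eq)
    have "laplacian u y = (\<Sum>i\<in>Basis. gg i y)"
      unfolding laplacian_def by (intro sum.cong refl p2 y)
    then show "(\<Sum>i\<in>Basis. extend (gg i) y) + a / snd y * extend (g (0, 1)) y = - h (extend u y)"
      using eq[rule_format, OF y] p1[OF b01 y] by (simp add: extend_eq[OF y])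
  qed
qed

lemma green_kernel_eq:
  fixes x y :: "(real^'n::finite) \<times> real"
  shows "green_kernel (a + 1) x y = green_const TYPE('n) (a + 1) *
    (LINT \<tau>|om a. qf x y \<tau> powr (- ((real CARD('n) + a - 1) / 2)))"
proof -
  have [measurable]: "qf x y \<in> borel_measurable borel"
    unfolding qf_def[abs_def] by measurable
  have e: "- (real CARD('n) + (a + 1) - 2) / 2 = - ((real CARD('n) + a - 1) / 2)" by (simp add: field_simps)
  show ?thesis
    unfolding green_kernel_def set_lebesgue_integral_def e
    by (subst integral_om) (auto simp: qf_def mult_ac)
qed

theorem lemma3p2:
  fixes n :: nat and b c \<tau> :: real and u :: "(real ^ 'n::finite) \<times> real \<Rightarrow> real"
  assumes "n = CARD('n)" and "n \<ge> 3" and "b > 1" and "c \<ge> 0"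
    and "\<tau> = (real n + b + 2) / (real n + b - 2)"
    and "C_closure 2 half_space u"
    and "\<forall>x\<in>half_space. u x > 0"
    and "\<forall>x\<in>half_space.
           laplacian u x + (b - 1) / snd x * partial (0, 1) u x + c * u x powr \<tau> = 0"
    and "\<forall>x'. ((\<lambda>t. u (x', t)) has_real_derivative 0) (at_right 0)"
    and "decays_like u closed_half_space (real n + b - 2)"
  shows "\<forall>x\<in>half_space.
           u x = c * (LINT y:half_space|lborel.
                        green_kernel b x y * snd y powr (b - 1) * u y powr \<tau>)"
proof
  fix x :: "(real^'n) \<times> real" assume x: "x \<in> half_space"
  define a where "a = b - 1"
  define k where "k = (real CARD('n) + a - 1) / 2"
  have a: "a > 0" and b: "b = a + 1" and k: "k > 0" and \<tau>: "\<tau> \<ge> 0"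
    using assms by (simp_all add: a_def k_def)
  define U where "U = extend u"
  \<comment> \<open>Written with the extension \<open>U\<close>, so that \<open>f\<close> is Borel
    on the whole space; on the half space it is the nonlinearity of the equation.\<close>
  define f where "f y = c * U y powr \<tau>" for y
  have Uu: "U y = u y" if "y \<in> half_space" for y unfolding U_def using that by (rule extend_eq)
  have sol: "weighted_poisson a U f"
    unfolding U_def f_def using assms(6,8)
    by (intro weighted_poisson_extend[where h = "\<lambda>r. c * r powr \<tau>"]) (simp_all add: a_def)
  have cU: "continuous_on UNIV U" and [measurable]: "f \<in> borel_measurable borel"
    using sol by (auto simp: weighted_poisson_def)
  have "(u \<longlongrightarrow> 0) (inf at_infinity (principal half_space))"
    using assms by (intro decays_like_tendsto_0) auto
  then have lim: "(U \<longlongrightarrow> 0) (inf at_infinity (principal half_space))"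
    by (rule Lim_transform_eventually) (simp add: eventually_inf_principal Uu)
  obtain B where B: "\<And>y. y \<in> half_space \<Longrightarrow> \<bar>U y\<bar> \<le> B"
    using bounded_if_tendsto_0[OF cU lim] by blast
  have f0: "f y \<ge> 0" for y using assms(4) by (simp add: f_def)
  have fB: "\<bar>f y\<bar> \<le> c * B powr \<tau>" if "y \<in> half_space" for y
  proof -
    have "0 \<le> U y" "U y \<le> B" using B[OF that] assms(7) that by (auto simp: Uu less_imp_le)
    then have "U y powr \<tau> \<le> B powr \<tau>" using \<tau> by (intro powr_mono2) auto
    then show ?thesis using assms(4) by (simp add: f_def mult_left_mono)
  qed
  note rep = newtonian_representation[OF a k_def k sol B fB f0 lim x]
  interpret mu: sigma_finite_measure "mu a :: ((real^'n) \<times> real) measure" by (rule sigma_finite_mu)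
  interpret om: finite_measure "om a" by (rule finite_om[OF a])
  interpret pair_sigma_finite "mu a :: ((real^'n) \<times> real) measure" "om a" ..
  let ?D = "green_const TYPE('n) b"
  let ?I = "\<lambda>y. LINT \<tau>|om a. f (fst (y, \<tau>)) * qf x (fst (y, \<tau>)) (snd (y, \<tau>)) powr (- k)"
  have Im: "?I \<in> borel_measurable borel"
    using borel_measurable_integrable[OF integrable_fst'[OF rep(1)]] by (simp add: measurable_cong_sets[OF sets_mu refl])
  have D: "?D * bump_mass TYPE('n) a k = 1" unfolding b by (rule green_const_bump_mass[OF a k_def k])
  \<comment> \<open>Valid also at y = x: both sides contain the same integral over \<tau>, whatever
    value it has there.\<close>
  have pt: "?D * (indicator half_space y * snd y powr a * ?I y) =
       c * (indicator half_space y *\<^sub>R (green_kernel b x y * snd y powr (b - 1) * u y powr \<tau>))" for y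
  proof (cases "y \<in> half_space")
    case True
    have "green_kernel b x y = ?D * (LINT \<tau>|om a. qf x y \<tau> powr (- k))"
      unfolding b k_def by (rule green_kernel_eq)
    then show ?thesis using True by (simp add: f_def Uu b)
  qed simp
  have "(LINT z|nu a. f (fst z) * qf x (fst z) (snd z) powr (- k)) = u x * bump_mass TYPE('n) a k"
    unfolding Uu[OF x, symmetric] by (rule rep(2))
  then have "u x = ?D * (LINT z|nu a. f (fst z) * qf x (fst z) (snd z) powr (- k))"
    using D by (simp add: mult.left_commute)
  also have "(LINT z|nu a. f (fst z) * qf x (fst z) (snd z) powr (- k)) = (LINT y|mu a. ?I y)"
    by (rule integral_fst'[OF rep(1), symmetric])
  also have "\<dots> = (LINT y|lborel. indicator half_space y * snd y powr a * ?I y)"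
    by (rule integral_mu(1)[OF Im])
  also have "?D * \<dots> = (LINT y|lborel. ?D * (indicator half_space y * snd y powr a * ?I y))"
    by (rule integral_mult_right_zero[symmetric])
  also have "\<dots> = (LINT y|lborel. c * (indicator half_space y *\<^sub>R (green_kernel b x y * snd y powr (b - 1) * u y powr \<tau>)))"
    by (simp only: pt)
  also have "\<dots> = c * (LINT y:half_space|lborel. green_kernel b x y * snd y powr (b - 1) * u y powr \<tau>)"
    by (simp add: set_lebesgue_integral_def)
  finally show "u x = c * (LINT y:half_space|lborel. green_kernel b x y * snd y powr (b - 1) * u y powr \<tau>)" .
qed

end
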